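(* There is a pointed algebraic domain $E$ such that $\mathbf{Disc}$ is an FS-domain and $[\mathbf{Disc}\to E]$ is not continuous.
   Context: A domain is a nonempty continuous dcpo; directed sets are nonempty; a dcpo is pointed if it has a least element. $[X\to Y]$ is the dcpo of Scott-continuous maps $X\to Y$ ordered pointwise. $\mathbf{Disc}$ is the dcpo of all closed disks in the Euclidean plane $\mathbb R^2$ (radius $r\ge0$), together with the whole plane as least element, ordered by reverse inclusion. A Scott-continuous map $f:X\to X$ on a domain $X$ is finitely separated from $\mathrm{id}_X$ if there is a finite set $M\subseteq X$ such that for every $x\in X$ some $m\in M$ satisfies $f(x)\le m\le x$. $X$ is an FS-domain if there is a directed family in $[X\to X]$, consisting of maps finitely separated from the identity, whose supremum is $\mathrm{id}_X$. *)

theory Defs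
  imports "HOL-Analysis.Analysis" "HOL-Algebra.Order"
begin

text \<open>Posets are records \<open>L\<close> with \<^locale>\<open>partial_order\<close>; \<open>least L s (Upper L D)\<close> says that
  \<open>s\<close> is the supremum of \<open>D\<close> in \<open>L\<close>.\<close>

definition directed_in :: "'a gorder \<Rightarrow> 'a set \<Rightarrow> bool" where
  "directed_in L D \<longleftrightarrow>
     D \<subseteq> carrier L \<and> D \<noteq> {} \<and>
     (\<forall>x\<in>D. \<forall>y\<in>D. \<exists>z\<in>D. x \<sqsubseteq>\<^bsub>L\<^esub> z \<and> y \<sqsubseteq>\<^bsub>L\<^esub> z)"

abbreviation is_sup :: "'a gorder \<Rightarrow> 'a \<Rightarrow> 'a set \<Rightarrow> bool" where
  "is_sup L s D \<equiv> least L s (Upper L D)"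

definition dcpo :: "'a gorder \<Rightarrow> bool" where
  "dcpo L \<longleftrightarrow> partial_order L \<and> (\<forall>D. directed_in L D \<longrightarrow> (\<exists>s. is_sup L s D))"

definition pointed :: "'a gorder \<Rightarrow> bool" where
  "pointed L \<longleftrightarrow> (\<exists>b. least L b (carrier L))"

definition way_below :: "'a gorder \<Rightarrow> 'a \<Rightarrow> 'a \<Rightarrow> bool" where
  "way_below L x y \<longleftrightarrow>
     x \<in> carrier L \<and> y \<in> carrier L \<and>
     (\<forall>D s. directed_in L D \<longrightarrow> is_sup L s D \<longrightarrow> y \<sqsubseteq>\<^bsub>L\<^esub> s \<longrightarrow> (\<exists>d\<in>D. x \<sqsubseteq>\<^bsub>L\<^esub> d))"

definition compact_element :: "'a gorder \<Rightarrow> 'a \<Rightarrow> bool" where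
  "compact_element L k \<longleftrightarrow> way_below L k k"

text \<open>Continuity is kept separate from directed completeness, so that its negation cannot hold
  merely because some directed supremum is missing.\<close>

definition continuous_poset :: "'a gorder \<Rightarrow> bool" where
  "continuous_poset L \<longleftrightarrow>
     (\<forall>x\<in>carrier L. directed_in L {y. way_below L y x} \<and> is_sup L x {y. way_below L y x})"

definition algebraic_poset :: "'a gorder \<Rightarrow> bool" where
  "algebraic_poset L \<longleftrightarrow>
     (\<forall>x\<in>carrier L. directed_in L {k. compact_element L k \<and> k \<sqsubseteq>\<^bsub>L\<^esub> x} \<and>
                    is_sup L x {k. compact_element L k \<and> k \<sqsubseteq>\<^bsub>L\<^esub> x})"

definition domain_poset :: "'a gorder \<Rightarrow> bool" where
  "domain_poset L \<longleftrightarrow> carrier L \<noteq> {} \<and> dcpo L \<and> continuous_poset L"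

definition algebraic_domain :: "'a gorder \<Rightarrow> bool" where
  "algebraic_domain L \<longleftrightarrow> domain_poset L \<and> algebraic_poset L"

definition scott_continuous :: "'a gorder \<Rightarrow> 'b gorder \<Rightarrow> ('a \<Rightarrow> 'b) \<Rightarrow> bool" where
  "scott_continuous X Y f \<longleftrightarrow>
     f \<in> carrier X \<rightarrow> carrier Y \<and> isotone X Y f \<and>
     (\<forall>D s. directed_in X D \<longrightarrow> is_sup X s D \<longrightarrow> is_sup Y (f s) (f ` D))"

text \<open>Maps are made \<^const>\<open>extensional\<close> on \<open>carrier X\<close>, so that a map is determined by its values
  on the carrier and the pointwise order is antisymmetric.\<close>

definition fun_space :: "'a gorder \<Rightarrow> 'b gorder \<Rightarrow> ('a \<Rightarrow> 'b) gorder" where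
  "fun_space X Y =
     \<lparr>carrier = {f \<in> extensional (carrier X). scott_continuous X Y f},
      eq = (=),
      le = (\<lambda>f g. \<forall>x\<in>carrier X. f x \<sqsubseteq>\<^bsub>Y\<^esub> g x)\<rparr>"

definition finitely_separated :: "'a gorder \<Rightarrow> ('a \<Rightarrow> 'a) \<Rightarrow> bool" where
  "finitely_separated X f \<longleftrightarrow>
     (\<exists>M. finite M \<and> M \<subseteq> carrier X \<and>
          (\<forall>x\<in>carrier X. \<exists>m\<in>M. f x \<sqsubseteq>\<^bsub>X\<^esub> m \<and> m \<sqsubseteq>\<^bsub>X\<^esub> x))"

definition FS_domain :: "'a gorder \<Rightarrow> bool" where
  "FS_domain X \<longleftrightarrow>
     domain_poset X \<and>
     (\<exists>F. directed_in (fun_space X X) F \<and>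
          (\<forall>f\<in>F. finitely_separated X f) \<and>
          is_sup (fun_space X X) (restrict id (carrier X)) F)"

definition Disc :: "(real^2) set gorder" where
  "Disc = \<lparr>carrier = insert UNIV {cball c r | c r. 0 \<le> r}, eq = (=), le = (\<lambda>A B. B \<subseteq> A)\<rparr>"

text \<open>HOL cannot quantify existentially over types, so an existentially quantified poset needs a
  fixed ambient type. The type \<open>disc_ambient\<close>, of cardinality \<open>beth_3\<close>, accommodates an isomorphic
  copy of every poset of at most that cardinality, in particular of every algebraic dcpo with at
  most \<open>beth_2\<close> compact elements; ideals of \<^const>\<open>Disc\<close> are elements of it directly.\<close>

type_synonym disc_ambient = "(real^2) set set"

end

(* Let P be the finite sets of codes of rational disks that contain a least disk, each disk having
   uncountably many codes, and let E be the ideal completion of P. The map sending a disk x to all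
   A in P whose disks are neighbourhoods of x has, as its maps way below, only those that use finitely
   many codes in total: otherwise delete from the values of the limit map all but finitely many members
   of an infinite sequence of codes in use. Replacing the ideal g(x) by the least disk it mentions thus
   turns a continuous function space into finite-valued monotone maps d with x inside d(x), uniformly
   close to the identity of Disc.

   Such maps do not exist. In the coordinates (centre, -radius), inclusion of disks is the causal order
   of (2+1)-dimensional Minkowski space. Where d jumps between two values, the jump of the radius of d
   along a vertical step is bounded by the jumps, along null steps in the four axis directions, of the
   support functions of d in those directions. But d being near the identity, the radius must change
   by about 1 along a vertical line of length 1, whereas the support function in direction e hardly
   changes along null lines in direction e. The finitely many values of d guarantee that at a small
   scale almost all jumps are of this simple form. *)
theory Submission
  imports Defs
begin

subsection \<open>Posets and function spaces\<close>

text \<open>That \<open>Disc\<close> is an FS-domain does not contradict the failure of continuity,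
  because finite separation does not bound the number of values: the maps \<open>coarsen n\<close>
  have infinite range. The obstruction is that values must be disks. If intersections of finitely
  many disks were allowed, one could send \<open>x\<close> to the intersection of all members of a
  finite net that are neighbourhoods of \<open>x\<close>, a finite-valued monotone map close to the
  identity. Hence the least disk demanded of the elements of \<open>P\<close>. Uncountably many
  codes per disk outlast the deletion of a sequence, which keeps every \<open>cover Q x\<close>
  directed.

  Finiteness enters the geometry in a non-uniform way. Over a fixed centre the regions of the
  finitely many values end at finitely many heights, so distinct heights have a positive minimal
  gap, but this gap need not be bounded below uniformly in the centre. The centres with a gap at
  most \<open>4 * k\<close> merely form a set that shrinks to the empty set with \<open>k\<close>.
  Inside a bounded box its measure tends to 0, and most points of a suitably translated grid of mesh
  \<open>k\<close> avoid it.\<close>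

lemma is_sup_iff:
  assumes "D \<subseteq> carrier L"
  shows "is_sup L s D \<longleftrightarrow> s \<in> carrier L \<and> (\<forall>x\<in>D. x \<sqsubseteq>\<^bsub>L\<^esub> s) \<and>
    (\<forall>u\<in>carrier L. (\<forall>x\<in>D. x \<sqsubseteq>\<^bsub>L\<^esub> u) \<longrightarrow> s \<sqsubseteq>\<^bsub>L\<^esub> u)"
proof -
  have "Upper L D = {u \<in> carrier L. \<forall>x\<in>D. x \<sqsubseteq>\<^bsub>L\<^esub> u}"
    using assms unfolding Upper_def by blast
  then show ?thesis by (simp add: least_def Ball_def subset_iff imp_conjL conj_assoc)
qed

lemma partial_orderI_rel:
  assumes "\<And>x. x \<in> A \<Longrightarrow> R x x"
    and "\<And>x y. x \<in> A \<Longrightarrow> y \<in> A \<Longrightarrow> R x y \<Longrightarrow> R y x \<Longrightarrow> x = y"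
    and "\<And>x y z. x \<in> A \<Longrightarrow> y \<in> A \<Longrightarrow> z \<in> A \<Longrightarrow> R x y \<Longrightarrow> R y z \<Longrightarrow> R x z"
  shows "partial_order \<lparr>carrier = A, eq = (=), le = R\<rparr>"
  (is "partial_order ?L")
proof unfold_locales
  show "x \<sqsubseteq>\<^bsub>?L\<^esub> x" if "x \<in> carrier ?L" for x
    using that assms(1) by simp
  show "x .=\<^bsub>?L\<^esub> y" if "x \<sqsubseteq>\<^bsub>?L\<^esub> y" "y \<sqsubseteq>\<^bsub>?L\<^esub> x" "x \<in> carrier ?L" "y \<in> carrier ?L" for x y
    using that assms(2)[of x y] by simp
  show "x \<sqsubseteq>\<^bsub>?L\<^esub> z" if "x \<sqsubseteq>\<^bsub>?L\<^esub> y" "y \<sqsubseteq>\<^bsub>?L\<^esub> z" "x \<in> carrier ?L" "y \<in> carrier ?L" "z \<in> carrier ?L" for x y z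
    using that assms(3)[of x y z] by simp
qed auto

lemma directed_in_finite:
  assumes "partial_order L" "directed_in L D" "finite F" "F \<subseteq> D"
  shows "\<exists>z\<in>D. \<forall>x\<in>F. x \<sqsubseteq>\<^bsub>L\<^esub> z"
  using assms(3,4)
proof (induction F)
  case empty
  then show ?case using assms(2) by (auto simp: directed_in_def)
next
  case (insert x F)
  interpret partial_order L by fact
  obtain z where z: "z \<in> D" "\<forall>y\<in>F. y \<sqsubseteq>\<^bsub>L\<^esub> z" using insert by auto
  then obtain w where w: "w \<in> D" "x \<sqsubseteq>\<^bsub>L\<^esub> w" "z \<sqsubseteq>\<^bsub>L\<^esub> w"
    using assms(2) insert.prems unfolding directed_in_def by blast
  have "D \<subseteq> carrier L" using assms(2) by (auto simp: directed_in_def)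
  then have "y \<sqsubseteq>\<^bsub>L\<^esub> w" if "y \<in> F" for y
    using le_trans[of y z w] z w that insert.prems by blast
  then show ?case using w by auto
qed

lemma scott_continuousI:
  assumes "partial_order X" "partial_order Y"
    and maps: "\<And>x. x \<in> carrier X \<Longrightarrow> f x \<in> carrier Y"
    and mono: "\<And>x y. x \<in> carrier X \<Longrightarrow> y \<in> carrier X \<Longrightarrow> x \<sqsubseteq>\<^bsub>X\<^esub> y \<Longrightarrow> f x \<sqsubseteq>\<^bsub>Y\<^esub> f y"
    and sup: "\<And>D s u. directed_in X D \<Longrightarrow> is_sup X s D \<Longrightarrow> u \<in> carrier Y \<Longrightarrow>
        (\<And>x. x \<in> D \<Longrightarrow> f x \<sqsubseteq>\<^bsub>Y\<^esub> u) \<Longrightarrow> f s \<sqsubseteq>\<^bsub>Y\<^esub> u"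
  shows "scott_continuous X Y f"
proof -
  interpret X: partial_order X by fact
  interpret Y: partial_order Y by fact
  have "is_sup Y (f s) (f ` D)" if D: "directed_in X D" "is_sup X s D" for D s
  proof -
    have sub: "D \<subseteq> carrier X" using D(1) by (simp add: directed_in_def)
    then have s: "s \<in> carrier X" "\<forall>x\<in>D. x \<sqsubseteq>\<^bsub>X\<^esub> s" using D(2) by (simp_all add: is_sup_iff)
    have "f ` D \<subseteq> carrier Y" using sub maps by blast
    then show ?thesis
      unfolding is_sup_iff[OF \<open>f ` D \<subseteq> carrier Y\<close>]
      using sub s maps mono sup[OF D] by (simp add: subset_iff)
  qed
  then show ?thesis
    unfolding scott_continuous_def isotone_def
    using X.weak_partial_order_axioms Y.weak_partial_order_axioms maps mono by auto
qed

lemma scott_continuousD: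
  assumes "scott_continuous X Y f"
  shows "\<And>x. x \<in> carrier X \<Longrightarrow> f x \<in> carrier Y"
    and "\<And>x y. x \<in> carrier X \<Longrightarrow> y \<in> carrier X \<Longrightarrow> x \<sqsubseteq>\<^bsub>X\<^esub> y \<Longrightarrow> f x \<sqsubseteq>\<^bsub>Y\<^esub> f y"
    and "\<And>D s. directed_in X D \<Longrightarrow> is_sup X s D \<Longrightarrow> is_sup Y (f s) (f ` D)"
  using assms by (auto simp: scott_continuous_def isotone_def)

lemma carrier_fun_space:
  "f \<in> carrier (fun_space X Y) \<longleftrightarrow> f \<in> extensional (carrier X) \<and> scott_continuous X Y f"
  by (simp add: fun_space_def)

lemma le_fun_space: "f \<sqsubseteq>\<^bsub>fun_space X Y\<^esub> g \<longleftrightarrow> (\<forall>x\<in>carrier X. f x \<sqsubseteq>\<^bsub>Y\<^esub> g x)"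
  by (simp add: fun_space_def)

lemma partial_order_fun_space:
  assumes "partial_order Y"
  shows "partial_order (fun_space X Y)"
proof -
  interpret Y: partial_order Y by fact
  show ?thesis
    unfolding fun_space_def
  proof (rule partial_orderI_rel)
    fix f g assume *: "f \<in> {f \<in> extensional (carrier X). scott_continuous X Y f}"
      "g \<in> {f \<in> extensional (carrier X). scott_continuous X Y f}"
      "\<forall>x\<in>carrier X. f x \<sqsubseteq>\<^bsub>Y\<^esub> g x" "\<forall>x\<in>carrier X. g x \<sqsubseteq>\<^bsub>Y\<^esub> f x"
    show "f = g"
    proof (rule extensionalityI[of _ "carrier X"])
      fix x assume "x \<in> carrier X"
      then show "f x = g x" using * scott_continuousD(1)[of X Y f x] scott_continuousD(1)[of X Y g x]
        by (intro Y.le_antisym) auto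
    qed (use * in auto)
  next
    fix f g h assume *: "f \<in> {f \<in> extensional (carrier X). scott_continuous X Y f}"
      "g \<in> {f \<in> extensional (carrier X). scott_continuous X Y f}"
      "h \<in> {f \<in> extensional (carrier X). scott_continuous X Y f}"
      "\<forall>x\<in>carrier X. f x \<sqsubseteq>\<^bsub>Y\<^esub> g x" "\<forall>x\<in>carrier X. g x \<sqsubseteq>\<^bsub>Y\<^esub> h x"
    then show "\<forall>x\<in>carrier X. f x \<sqsubseteq>\<^bsub>Y\<^esub> h x"
      by (auto intro: Y.le_trans scott_continuousD(1))
  qed (auto intro: Y.le_refl scott_continuousD(1))
qed

lemma scott_continuous_restrict:
  assumes "partial_order X" and f: "scott_continuous X Y f"
  shows "restrict f (carrier X) \<in> carrier (fun_space X Y)"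
proof -
  have "is_sup Y (restrict f (carrier X) s) (restrict f (carrier X) ` D)"
    if D: "directed_in X D" "is_sup X s D" for D s
  proof -
    have "D \<subseteq> carrier X" using D(1) by (simp add: directed_in_def)
    moreover from this have "s \<in> carrier X" using D(2) by (simp add: is_sup_iff)
    moreover have "restrict f (carrier X) ` D = f ` D" using \<open>D \<subseteq> carrier X\<close> by auto
    ultimately show ?thesis using scott_continuousD(3)[OF f D] by simp
  qed
  then show ?thesis
    using f by (auto simp: carrier_fun_space scott_continuous_def isotone_def)
qed

subsection \<open>The domain of disks\<close>

lemma carrier_Disc: "x \<in> carrier Disc \<longleftrightarrow> x = UNIV \<or> (\<exists>c r. 0 \<le> r \<and> x = cball c r)"
  by (auto simp: Disc_def)

lemma cball_in_Disc [simp]: "0 \<le> r \<Longrightarrow> cball c r \<in> carrier Disc"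
  by (auto simp: carrier_Disc)

lemma UNIV_in_Disc [simp]: "UNIV \<in> carrier Disc"
  by (simp add: carrier_Disc)

lemma le_Disc [simp]: "x \<sqsubseteq>\<^bsub>Disc\<^esub> y \<longleftrightarrow> y \<subseteq> x"
  by (simp add: Disc_def)

lemma partial_order_Disc: "partial_order Disc"
  unfolding Disc_def by (rule partial_orderI_rel) auto

lemma closed_Disc: "x \<in> carrier Disc \<Longrightarrow> closed x"
  by (auto simp: carrier_Disc)

lemma Disc_cases:
  assumes "x \<in> carrier Disc" "x \<noteq> UNIV"
  obtains c r where "x = cball c r" "0 \<le> r"
  using assms by (auto simp: carrier_Disc)

lemma directed_DiscD:
  assumes "directed_in Disc D"
  shows "D \<subseteq> carrier Disc" "D \<noteq> {}"
    "\<And>F. finite F \<Longrightarrow> F \<subseteq> D \<Longrightarrow> \<exists>z\<in>D. \<forall>x\<in>F. z \<subseteq> x"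
  using assms directed_in_finite[OF partial_order_Disc assms] by (auto simp: directed_in_def)

text \<open>Compactness: if no member of \<open>D\<close> lay in \<open>U\<close>, then within one
  bounded member the parts outside \<open>U\<close> would have the finite intersection property and
  leave a point of the intersection outside \<open>U\<close>. The family consisting of the plane
  alone has no bounded member and is treated separately.\<close>

lemma directed_Disc_subset_open:
  assumes D: "directed_in Disc D" and sub: "\<Inter>D \<subseteq> U" and "open U"
  shows "\<exists>x\<in>D. x \<subseteq> U"
proof (cases "D \<subseteq> {UNIV}")
  case True
  then have "D = {UNIV}" using directed_DiscD(2)[OF D] by blast
  then show ?thesis using sub by auto
next
  case False
  then obtain c r where x0: "cball c r \<in> D"
    using directed_DiscD(1)[OF D] by (blast elim: Disc_cases)
  show ?thesis
  proof (rule ccontr)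
    assume no: "\<not> ?thesis"
    have "(cball c r - U) \<inter> \<Inter>D \<noteq> {}"
    proof (rule compact_imp_fip)
      show "compact (cball c r - U)" using \<open>open U\<close> by (simp add: compact_diff)
      show "closed T" if "T \<in> D" for T using that directed_DiscD(1)[OF D] closed_Disc by blast
      show "(cball c r - U) \<inter> \<Inter>F \<noteq> {}" if "finite F" "F \<subseteq> D" for F
      proof -
        obtain z where "z \<in> D" "\<forall>x\<in>insert (cball c r) F. z \<subseteq> x"
          using directed_DiscD(3)[OF D, of "insert (cball c r) F"] x0 \<open>finite F\<close> \<open>F \<subseteq> D\<close> by auto
        then show ?thesis using no by blast
      qed
    qed
    then show False using sub by auto
  qed
qed

text \<open>The radius of the limit disk is the infimum \<open>\<rho>\<close> of the radii. Its
  centre is a common point of all disks with radius reduced by \<open>\<rho>\<close>: finitely many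
  of these contain the centre of any member that lies in all the corresponding disks, and
  compactness does the rest.\<close>

lemma directed_Disc_Inter:
  assumes D: "directed_in Disc D"
  shows "\<Inter>D \<in> carrier Disc"
proof (cases "D \<subseteq> {UNIV}")
  case True
  then have "\<Inter>D = UNIV" by auto
  then show ?thesis using UNIV_in_Disc by metis
next
  case False
  define I where "I = {(c, r). 0 \<le> r \<and> cball c r \<in> D}"
  define \<rho> where "\<rho> = Inf (snd ` I)"
  obtain c0 r0 where 0: "(c0, r0) \<in> I"
    using False directed_DiscD(1)[OF D] by (force simp: carrier_Disc I_def)
  have bdd: "bdd_below (snd ` I)" by (rule bdd_belowI[of _ 0]) (auto simp: I_def)
  have \<rho>_le: "\<rho> \<le> r" if "(c, r) \<in> I" for c r
    unfolding \<rho>_def using that bdd by (intro cInf_lower) force+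
  have \<rho>0: "0 \<le> \<rho>" unfolding \<rho>_def using 0 by (intro cInf_greatest) (auto simp: I_def)
  have "cball c0 (r0 - \<rho>) \<inter> (\<Inter>(c, r)\<in>I. cball c (r - \<rho>)) \<noteq> {}"
  proof (rule compact_imp_fip_image)
    show "closed (case i of (c, r) \<Rightarrow> cball c (r - \<rho>))" for i by (cases i) simp
    show "cball c0 (r0 - \<rho>) \<inter> (\<Inter>(c, r)\<in>I'. cball c (r - \<rho>)) \<noteq> {}" if I': "finite I'" "I' \<subseteq> I" for I'
    proof -
      define F where "F = (\<lambda>(c, r). cball c r) ` insert (c0, r0) I'"
      have "finite F" "F \<subseteq> D" using I' 0 by (auto simp: F_def I_def)
      then obtain z where z: "z \<in> D" "\<forall>x\<in>F. z \<subseteq> x" using directed_DiscD(3)[OF D] by blast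
      then have sub: "z \<subseteq> cball c r" if "(c, r) \<in> insert (c0, r0) I'" for c r using that by (force simp: F_def)
      then have "z \<noteq> UNIV" by (metis bounded_cball bounded_subset insertI1 not_bounded_UNIV)
      then obtain c' r' where z': "z = cball c' r'" "0 \<le> r'"
        using z(1) directed_DiscD(1)[OF D] by (blast elim: Disc_cases)
      then have "(c', r') \<in> I" using z(1) by (auto simp: I_def)
      then have "c' \<in> cball c (r - \<rho>)" if "(c, r) \<in> insert (c0, r0) I'" for c r
        using sub[OF that] z' \<rho>_le[of c' r'] by (auto simp: cball_subset_cball_iff dist_commute)
      then show ?thesis by blast
    qed
  qed simp
  then obtain c where c: "\<And>c' r'. (c', r') \<in> I \<Longrightarrow> dist c' c \<le> r' - \<rho>" by force
  have "\<Inter>D = cball c \<rho>"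
  proof
    show "cball c \<rho> \<subseteq> \<Inter>D"
    proof (rule Inter_greatest)
      fix x assume x: "x \<in> D"
      show "cball c \<rho> \<subseteq> x"
      proof (cases "x = UNIV")
        case False
        then obtain c' r' where x': "x = cball c' r'" "0 \<le> r'"
          using x directed_DiscD(1)[OF D] by (blast elim: Disc_cases)
        then have "dist c' c \<le> r' - \<rho>" using c x by (auto simp: I_def)
        then show ?thesis using x' by (auto simp: cball_subset_cball_iff dist_commute)
      qed simp
    qed
    show "\<Inter>D \<subseteq> cball c \<rho>"
    proof
      fix y assume y: "y \<in> \<Inter>D"
      have "dist c y \<le> \<rho> + e" if "0 < e" for e
      proof -
        have "\<exists>r\<in>snd ` I. r < \<rho> + e / 2"
          using that cInf_less_iff[of "snd ` I" "\<rho> + e / 2"] 0 bdd unfolding \<rho>_def by force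
        then obtain c' r' where I: "(c', r') \<in> I" "r' < \<rho> + e / 2" by auto
        then have "dist c' y \<le> r'" using y by (auto simp: I_def)
        then show ?thesis using c[OF I(1)] I(2) dist_triangle[of c y c'] by (simp add: dist_commute)
      qed
      then show "y \<in> cball c \<rho>" by (auto intro: field_le_epsilon)
    qed
  qed
  then show ?thesis using \<rho>0 by simp
qed

lemma is_sup_Disc:
  assumes D: "directed_in Disc D"
  shows "is_sup Disc s D \<longleftrightarrow> s = \<Inter>D"
proof -
  have "D \<subseteq> carrier Disc" "\<Inter>D \<in> carrier Disc"
    using directed_DiscD(1)[OF D] directed_Disc_Inter[OF D] by simp_all
  show ?thesis
    unfolding is_sup_iff[OF \<open>D \<subseteq> carrier Disc\<close>] le_Disc
  proof
    assume *: "s \<in> carrier Disc \<and> (\<forall>x\<in>D. s \<subseteq> x) \<and> (\<forall>u\<in>carrier Disc. (\<forall>x\<in>D. u \<subseteq> x) \<longrightarrow> u \<subseteq> s)"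
    then have "\<Inter>D \<subseteq> s" using \<open>\<Inter>D \<in> carrier Disc\<close> by (simp add: Inf_lower)
    moreover have "s \<subseteq> \<Inter>D" using * by (simp add: Inf_greatest)
    ultimately show "s = \<Inter>D" by simp
  qed (use \<open>\<Inter>D \<in> carrier Disc\<close> in \<open>simp add: Inf_lower Inf_greatest\<close>)
qed

lemma Inter_thick: "(\<Inter>\<delta>\<in>{0<..}. cball c (r + \<delta>)) = cball c (r :: real)"
proof (intro equalityI subsetI)
  fix x assume "x \<in> (\<Inter>\<delta>\<in>{0<..}. cball c (r + \<delta>))"
  then have "dist c x \<le> r + \<delta>" if "0 < \<delta>" for \<delta> using that by simp
  then show "x \<in> cball c r" by (simp add: field_le_epsilon)
qed auto

text \<open>By \<open>Inter_thick\<close> the supremum of this family is \<open>cball c r\<close>.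
  It is the test family for way-below, for neighbourhoods of disks and for the openness condition on
  deflations.\<close>

lemma directed_thick: 
  assumes "0 \<le> r"
  shows "directed_in Disc ((\<lambda>\<delta>. cball c (r + \<delta>)) ` {0<..})"
proof -
  have "\<exists>z\<in>(\<lambda>\<delta>. cball c (r + \<delta>)) ` {0<..}. z \<subseteq> cball c (r + a) \<and> z \<subseteq> cball c (r + b)"
    if "0 < a" "0 < b" for a b :: real
    using that by (intro bexI[of _ "cball c (r + min a b)"]) auto
  then show ?thesis using assms unfolding directed_in_def by auto
qed

text \<open>\<open>directed_Disc_subset_open\<close> turns neighbourhoods into way-below. Conversely
  the thickenings of \<open>x\<close> converge to \<open>x\<close>, so one of them already lies in
  \<open>y\<close>; for the plane the singleton family plays their part.\<close>

lemma way_below_Disc: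
  "way_below Disc y x \<longleftrightarrow> x \<in> carrier Disc \<and> y \<in> carrier Disc \<and> x \<subseteq> interior y"
proof safe
  assume wb: "way_below Disc y x"
  then show car: "x \<in> carrier Disc" "y \<in> carrier Disc" by (auto simp: way_below_def)
  fix a assume a: "a \<in> x"
  consider "x = UNIV" | c r where "x = cball c r" "0 \<le> r" using car by (auto simp: carrier_Disc)
  then show "a \<in> interior y"
  proof cases
    case 1
    have D: "directed_in Disc {UNIV}" by (auto simp: directed_in_def)
    then have "UNIV \<subseteq> y" using wb 1 is_sup_Disc[OF D] by (auto simp: way_below_def)
    then show ?thesis by (simp add: top.extremum_unique)
  next
    case 2
    let ?F = "(\<lambda>\<delta>. cball c (r + \<delta>)) ` {0<..}"
    have "directed_in Disc ?F" "is_sup Disc x ?F" "x \<sqsubseteq>\<^bsub>Disc\<^esub> x"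
      using directed_thick[OF 2(2)] 2 by (simp_all add: is_sup_Disc Inter_thick)
    then have "\<exists>d\<in>?F. y \<sqsubseteq>\<^bsub>Disc\<^esub> d" using wb unfolding way_below_def by blast
    then obtain \<delta> where \<delta>: "0 < \<delta>" "cball c (r + \<delta>) \<subseteq> y" by auto
    then have "ball c (r + \<delta>) \<subseteq> interior y" by (meson ball_subset_cball interior_maximal open_ball order_trans)
    then show ?thesis using a 2 \<delta> by auto
  qed
next
  assume "x \<in> carrier Disc" "y \<in> carrier Disc" "x \<subseteq> interior y"
  then show "way_below Disc y x"
    unfolding way_below_def
  proof (intro conjI allI impI)
    fix D s assume D: "directed_in Disc D" "is_sup Disc s D" "x \<sqsubseteq>\<^bsub>Disc\<^esub> s"
    then have "\<Inter>D \<subseteq> interior y" using is_sup_Disc \<open>x \<subseteq> interior y\<close> by auto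
    then obtain d where "d \<in> D" "d \<subseteq> interior y" using directed_Disc_subset_open[OF D(1)] by blast
    then show "\<exists>d\<in>D. y \<sqsubseteq>\<^bsub>Disc\<^esub> d" using interior_subset[of y] by auto
  qed
qed

lemma Disc_subset_open:
  fixes c :: "real^2"
  assumes "0 \<le> r" "cball c r \<subseteq> U" "open U"
  obtains \<delta> where "0 < \<delta>" "cball c (r + \<delta>) \<subseteq> U"
proof -
  have "\<Inter>((\<lambda>\<delta>. cball c (r + \<delta>)) ` {0<..}) \<subseteq> U" using assms(2) by (simp only: Inter_thick)
  then have "\<exists>x\<in>(\<lambda>\<delta>. cball c (r + \<delta>)) ` {0<..}. x \<subseteq> U"
    by (rule directed_Disc_subset_open[OF directed_thick[OF assms(1)] _ assms(3)])
  then show ?thesis using that by auto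
qed

lemma domain_Disc: "domain_poset Disc"
proof -
  have "directed_in Disc {y. way_below Disc y x} \<and> is_sup Disc x {y. way_below Disc y x}"
    if x: "x \<in> carrier Disc" for x
  proof
    have sub: "x \<subseteq> y" if "way_below Disc y x" for y
      using that interior_subset[of y] unfolding way_below_Disc by blast
    have "\<exists>z. way_below Disc z x \<and> z \<subseteq> y1 \<and> z \<subseteq> y2"
      if y: "way_below Disc y1 x" "way_below Disc y2 x" for y1 y2
    proof (cases "x = UNIV")
      case True
      then have "y1 = UNIV" "y2 = UNIV" using y sub by blast+
      then show ?thesis using y by blast
    next
      case False
      with x obtain c r where x_eq: "x = cball c r" "0 \<le> r" by (rule Disc_cases)
      have sub2: "cball c r \<subseteq> interior y1 \<inter> interior y2"
        using y x_eq by (simp add: way_below_Disc)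
      obtain \<delta> where \<delta>: "0 < \<delta>" "cball c (r + \<delta>) \<subseteq> interior y1 \<inter> interior y2"
        by (rule Disc_subset_open[OF x_eq(2) sub2 open_Int[OF open_interior open_interior]])
      then have "way_below Disc (cball c (r + \<delta>)) x"
        using x_eq by (simp add: way_below_Disc cball_subset_ball_iff)
      then show ?thesis using \<delta>(2) interior_subset[of y1] interior_subset[of y2] by blast
    qed
    moreover have "way_below Disc UNIV x" using x by (simp add: way_below_Disc)
    moreover have "{y. way_below Disc y x} \<subseteq> carrier Disc" by (auto simp: way_below_def)
    ultimately show dir: "directed_in Disc {y. way_below Disc y x}"
      unfolding directed_in_def le_Disc by (metis (mono_tags, lifting) empty_iff mem_Collect_eq)
    have "\<Inter>{y. way_below Disc y x} \<subseteq> x"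
    proof (cases "x = UNIV")
      case False
      with x obtain c r where x_eq: "x = cball c r" "0 \<le> r" by (rule Disc_cases)
      then have "way_below Disc (cball c (r + \<delta>)) x" if "0 < \<delta>" for \<delta>
        using that by (simp add: way_below_Disc cball_subset_ball_iff)
      then have "\<Inter>{y. way_below Disc y x} \<subseteq> (\<Inter>\<delta>\<in>{0<..}. cball c (r + \<delta>))"
        by (intro INT_greatest Inter_lower) simp
      then show ?thesis by (simp only: Inter_thick x_eq)
    qed simp
    moreover have "x \<subseteq> \<Inter>{y. way_below Disc y x}" using sub by (intro Inter_greatest) simp
    ultimately show "is_sup Disc x {y. way_below Disc y x}"
      unfolding is_sup_Disc[OF dir] by (intro subset_antisym)
  qed
  moreover have "\<exists>s. is_sup Disc s D" if "directed_in Disc D" for D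
    using is_sup_Disc[OF that] by blast
  moreover have "carrier Disc \<noteq> {}" using UNIV_in_Disc by blast
  ultimately show ?thesis
    unfolding domain_poset_def dcpo_def continuous_poset_def
    using partial_order_Disc by simp
qed

section \<open>Finite separation: nets of disks and truncated thickenings\<close>

text \<open>The centre moves to a point of an \<open>e / 3\<close>-net. The radius is rounded up to
  a multiple of \<open>e / 3\<close> and then raised by one more, to make up for the moved centre;
  in total at most \<open>e\<close> is spent.\<close>

lemma disk_net:
  assumes "0 < e"
  obtains M where "finite M" "M \<subseteq> {cball c r |c r. 0 \<le> r}"
    "\<And>c r. 0 \<le> r \<Longrightarrow> cball c r \<subseteq> ball (0 :: real^2) n \<Longrightarrow> \<exists>m\<in>M. cball c r \<subseteq> m \<and> m \<subseteq> cball c (r + e)"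
proof -
  define \<eta> where "\<eta> = e / 3"
  have \<eta>: "0 < \<eta>" using assms by (simp add: \<eta>_def)
  obtain K where K: "finite K" "cball (0 :: real^2) n \<subseteq> (\<Union>x\<in>K. ball x \<eta>)"
    using compact_eq_totally_bounded[THEN iffD1, OF compact_cball[of "0 :: real^2" n], THEN conjunct2, rule_format, OF \<eta>]
    by (elim exE conjE)
  define M where "M = (\<lambda>(c, i). cball c (real i * \<eta>)) ` (K \<times> {..nat \<lceil>n / \<eta>\<rceil> + 1})"
  show ?thesis
  proof (rule that[of M])
    show "finite M" using K by (simp add: M_def)
    show "M \<subseteq> {cball c r |c r. 0 \<le> r}"
    proof
      fix m assume "m \<in> M"
      then obtain c i where "m = cball c (real i * \<eta>)" by (auto simp: M_def)
      then show "m \<in> {cball c r |c r. 0 \<le> r}"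
        using \<eta> by (intro CollectI exI[of _ c] exI[of _ "real i * \<eta>"]) simp
    qed
    fix c :: "real^2" and r assume r: "0 \<le> r" "cball c r \<subseteq> ball 0 n"
    then have cr: "norm c + r < n" by (simp add: cball_subset_ball_iff)
    then have "c \<in> cball 0 n" using r by simp
    then have "c \<in> (\<Union>x\<in>K. ball x \<eta>)" by (rule subsetD[OF K(2)])
    then obtain c' where "c' \<in> K" "c \<in> ball c' \<eta>" by (rule UN_E)
    then have c': "c' \<in> K" "dist c' c < \<eta>" by simp_all
    define i where "i = nat \<lceil>r / \<eta>\<rceil> + 1"
    have "r / \<eta> \<le> n / \<eta>" using cr norm_ge_zero[of c] \<eta> by (intro divide_right_mono) linarith+
    then have "nat \<lceil>r / \<eta>\<rceil> \<le> nat \<lceil>n / \<eta>\<rceil>" by (intro nat_mono ceiling_mono)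
    then have "i \<in> {..nat \<lceil>n / \<eta>\<rceil> + 1}" by (simp add: i_def)
    then have "cball c' (real i * \<eta>) \<in> M"
      unfolding M_def using c'(1) by (intro image_eqI[of _ _ "(c', i)"]) simp_all
    moreover have "0 \<le> r / \<eta>" using r \<eta> by simp
    then have "real i = of_int \<lceil>r / \<eta>\<rceil> + 1" by (simp add: i_def)
    then have "r / \<eta> + 1 \<le> i" "i \<le> r / \<eta> + 2" by linarith+
    then have "(r / \<eta> + 1) * \<eta> \<le> i * \<eta>" "i * \<eta> \<le> (r / \<eta> + 2) * \<eta>"
      using mult_right_mono[OF _ less_imp_le[OF \<eta>]] by blast+
    then have i: "r + \<eta> \<le> i * \<eta>" "i * \<eta> \<le> r + 2 * \<eta>"
      using \<eta> by (simp_all add: distrib_right)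
    have "e = 3 * \<eta>" by (simp add: \<eta>_def)
    have "dist c c' + r \<le> i * \<eta>" using i(1) c'(2) by (simp add: dist_commute)
    moreover have "dist c' c + i * \<eta> \<le> r + e" using i(2) c'(2) \<open>e = 3 * \<eta>\<close> by linarith
    ultimately have "cball c r \<subseteq> cball c' (real i * \<eta>)" "cball c' (real i * \<eta>) \<subseteq> cball c (r + e)"
      by (simp_all add: cball_subset_cball_iff)
    then show "\<exists>m\<in>M. cball c r \<subseteq> m \<and> m \<subseteq> cball c (r + e)"
      using \<open>cball c' (real i * \<eta>) \<in> M\<close> by blast
  qed
qed

text \<open>Junk (\<open>THE\<close> of an empty predicate) unless \<open>x\<close> is a closed disk.\<close>

definition thicken :: "real \<Rightarrow> (real^2) set \<Rightarrow> (real^2) set" where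
  "thicken e x = (THE y. \<exists>c r. 0 \<le> r \<and> x = cball c r \<and> y = cball c (r + e))"

lemma thicken_cball [simp]: "0 \<le> r \<Longrightarrow> thicken e (cball c r) = cball c (r + e)"
  unfolding thicken_def by (rule the_equality) (auto simp: cball_eq_cball_iff)

text \<open>A finite net can only serve a bounded region, so disks that leave it go to the least
  element. The region is an open ball because a directed family shrinking to a disk in the region
  must have members inside it.\<close>

definition coarsen :: "nat \<Rightarrow> (real^2) set \<Rightarrow> (real^2) set" where
  "coarsen n x = (if x \<subseteq> ball 0 (Suc n) then thicken (1 / Suc n) x else UNIV)"

lemma coarsen_cball:
  "0 \<le> r \<Longrightarrow> cball c r \<subseteq> ball 0 (Suc n) \<Longrightarrow> coarsen n (cball c r) = cball c (r + 1 / Suc n)"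
  by (simp add: coarsen_def)

lemma disk_in_ball:
  assumes "x \<in> carrier Disc" "x \<subseteq> ball 0 n"
  obtains c r where "x = cball c r" "0 \<le> r"
proof -
  have "bounded x" using bounded_ball assms(2) by (rule bounded_subset)
  then have "x \<noteq> UNIV" using not_bounded_UNIV by blast
  with assms(1) show ?thesis by (rule Disc_cases) (rule that)
qed

lemma coarsen_mono:
  assumes "x \<in> carrier Disc" "y \<in> carrier Disc" "x \<subseteq> y"
  shows "coarsen n x \<subseteq> coarsen n y"
proof (cases "y \<subseteq> ball 0 (Suc n)")
  case True
  then have "x \<subseteq> ball 0 (Suc n)" using assms(3) by blast
  then obtain c r where x: "x = cball c r" "0 \<le> r" using assms(1) disk_in_ball by blast
  obtain c' r' where y: "y = cball c' r'" "0 \<le> r'" using True assms(2) disk_in_ball by blast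
  have "dist c c' + r \<le> r'" using assms(3) x y by (auto simp: cball_subset_cball_iff)
  moreover have "coarsen n x = cball c (r + 1 / Suc n)" "coarsen n y = cball c' (r' + 1 / Suc n)"
    using x y True \<open>x \<subseteq> ball 0 (Suc n)\<close> coarsen_cball by blast+
  ultimately show ?thesis by (simp add: cball_subset_cball_iff)
qed (simp add: coarsen_def)

lemma coarsen_in_Disc:
  assumes "x \<in> carrier Disc"
  shows "coarsen n x \<in> carrier Disc"
proof (cases "x \<subseteq> ball 0 (Suc n)")
  case True
  with assms obtain c r where x: "x = cball c r" "0 \<le> r" by (rule disk_in_ball)
  then have "coarsen n x = cball c (r + 1 / Suc n)" using True coarsen_cball by blast
  then show ?thesis using x(2) by simp
qed (simp add: coarsen_def)

lemma scott_continuous_coarsen: "scott_continuous Disc Disc (coarsen n)"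
proof (rule scott_continuousI[OF partial_order_Disc partial_order_Disc])
  fix D s u assume D: "directed_in Disc D" "is_sup Disc s D"
    and u: "u \<in> carrier Disc" "\<And>x. x \<in> D \<Longrightarrow> coarsen n x \<sqsubseteq>\<^bsub>Disc\<^esub> u"
  have s: "s = \<Inter>D" "s \<in> carrier Disc" using D is_sup_Disc directed_Disc_Inter by auto
  show "coarsen n s \<sqsubseteq>\<^bsub>Disc\<^esub> u"
  proof (cases "s \<subseteq> ball 0 (Suc n)")
    case True
    then obtain c r where cr: "s = cball c r" "0 \<le> r" using s disk_in_ball by metis
    have "u \<subseteq> cball c (r + 1 / Suc n + \<delta>)" if "0 < \<delta>" for \<delta>
    proof -
      \<comment> \<open>A member of \<open>D\<close> this close to \<open>s\<close> is thickened
        rather than cut off, and its thickening exceeds that of \<open>s\<close> by at most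
        \<open>\<delta>\<close>.\<close>
      have "\<Inter>D \<subseteq> ball 0 (Suc n) \<inter> ball c (r + \<delta>)" using True cr s that by auto
      then obtain x where x: "x \<in> D" "x \<subseteq> ball 0 (Suc n)" "x \<subseteq> ball c (r + \<delta>)"
        using directed_Disc_subset_open[OF D(1)] by (metis le_inf_iff open_Int open_ball)
      then obtain c' r' where x': "x = cball c' r'" "0 \<le> r'"
        using directed_DiscD(1)[OF D(1)] disk_in_ball by (metis subsetD)
      have "u \<subseteq> coarsen n x" using u(2)[OF x(1)] by simp
      also have "\<dots> = cball c' (r' + 1 / Suc n)" using x x' by (simp add: coarsen_def)
      also have "\<dots> \<subseteq> cball c (r + 1 / Suc n + \<delta>)"
        using x(3) x' by (auto simp: cball_subset_cball_iff cball_subset_ball_iff)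
      finally show ?thesis .
    qed
    then have "u \<subseteq> (\<Inter>\<delta>\<in>{0<..}. cball c (r + 1 / Suc n + \<delta>))" by blast
    then show ?thesis using True cr by (simp only: Inter_thick) (simp add: coarsen_def)
  qed (simp add: coarsen_def)
qed (auto simp: coarsen_in_Disc coarsen_mono)

lemma Inter_coarsen:
  assumes "x \<in> carrier Disc" "\<And>n. u \<subseteq> coarsen n x"
  shows "u \<subseteq> x"
proof (cases "x = UNIV")
  case False
  then obtain c r where cr: "x = cball c r" "0 \<le> r" using assms by (auto simp: carrier_Disc)
  have "u \<subseteq> cball c (r + \<delta>)" if "0 < \<delta>" for \<delta>
  proof -
    obtain n1 where n1: "1 / Suc n1 < \<delta>" using reals_Archimedean[OF \<open>0 < \<delta>\<close>] by (auto simp: inverse_eq_divide)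
    obtain n2 where n2: "norm c + r < real n2" using reals_Archimedean2 by blast
    define n where "n = max n1 n2"
    have "1 / real (Suc n) \<le> 1 / Suc n1" by (intro divide_left_mono) (auto simp: n_def)
    moreover have "x \<subseteq> ball 0 (Suc n)" using n2 cr by (auto simp: cball_subset_ball_iff n_def)
    ultimately have "coarsen n x \<subseteq> cball c (r + \<delta>)" using n1 cr by (auto simp: coarsen_def)
    then show ?thesis using assms(2)[of n] by blast
  qed
  then have "u \<subseteq> (\<Inter>\<delta>\<in>{0<..}. cball c (r + \<delta>))" by blast
  then show ?thesis by (simp only: Inter_thick cr)
qed simp

lemma coarsen_infl:
  assumes "x \<in> carrier Disc"
  shows "x \<subseteq> coarsen n x"
proof (cases "x \<subseteq> ball 0 (Suc n)")
  case True
  then obtain c r where x: "x = cball c r" "0 \<le> r" using assms disk_in_ball by blast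
  then have "coarsen n x = cball c (r + 1 / Suc n)" using True coarsen_cball by blast
  then show ?thesis using x by (simp add: cball_subset_cball_iff)
qed (simp add: coarsen_def)

lemma coarsen_antimono:
  assumes "x \<in> carrier Disc" "n \<le> m"
  shows "coarsen m x \<subseteq> coarsen n x"
proof (cases "x \<subseteq> ball 0 (Suc n)")
  case True
  then obtain c r where "x = cball c r" "0 \<le> r" using assms disk_in_ball by metis
  moreover have "x \<subseteq> ball 0 (Suc m)" using True assms(2) by force
  moreover have "1 / real (Suc m) \<le> 1 / Suc n" using assms(2) by (intro divide_left_mono) auto
  ultimately show ?thesis using True by (auto simp: coarsen_def)
qed (simp add: coarsen_def)

text \<open>A net disk fits between \<open>x\<close> and its thickening; \<open>UNIV\<close>
  separates the disks that are cut off.\<close>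

lemma finitely_separated_coarsen: "finitely_separated Disc (coarsen n)"
proof -
  obtain M where M: "finite M" "M \<subseteq> {cball c r |c r. 0 \<le> r}"
    "\<And>c r. 0 \<le> r \<Longrightarrow> cball c r \<subseteq> ball (0 :: real^2) (Suc n) \<Longrightarrow> \<exists>m\<in>M. cball c r \<subseteq> m \<and> m \<subseteq> cball c (r + 1 / Suc n)"
    using disk_net[of "1 / Suc n" "Suc n"] by auto
  have "\<exists>m\<in>insert UNIV M. m \<subseteq> coarsen n x \<and> x \<subseteq> m" if "x \<in> carrier Disc" for x
  proof (cases "x \<subseteq> ball 0 (Suc n)")
    case True
    with that obtain c r where x: "x = cball c r" "0 \<le> r" by (rule disk_in_ball)
    then have "coarsen n x = cball c (r + 1 / Suc n)" using True coarsen_cball by blast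
    then show ?thesis using M(3)[of r c] True x by auto
  qed (simp add: coarsen_def)
  then show ?thesis
    unfolding finitely_separated_def using M by (intro exI[of _ "insert UNIV M"]) auto
qed

lemma FS_domain_Disc: "FS_domain Disc"
proof -
  define F where "F = (\<lambda>n. restrict (coarsen n) (carrier Disc)) ` UNIV"
  let ?FS = "fun_space Disc Disc"
  have F: "F \<subseteq> carrier ?FS"
    unfolding F_def using scott_continuous_restrict[OF partial_order_Disc scott_continuous_coarsen] by auto
  have "scott_continuous Disc Disc id"
  proof (rule scott_continuousI[OF partial_order_Disc partial_order_Disc])
    fix D s u assume "directed_in Disc D" "is_sup Disc s D" "\<And>x. x \<in> D \<Longrightarrow> id x \<sqsubseteq>\<^bsub>Disc\<^esub> u"
    then show "id s \<sqsubseteq>\<^bsub>Disc\<^esub> u" by (simp add: is_sup_Disc Inf_greatest)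
  qed auto
  then have id: "restrict id (carrier Disc) \<in> carrier ?FS"
    using scott_continuous_restrict[OF partial_order_Disc] by auto
  have "\<exists>z\<in>F. x \<sqsubseteq>\<^bsub>?FS\<^esub> z \<and> y \<sqsubseteq>\<^bsub>?FS\<^esub> z" if "x \<in> F" "y \<in> F" for x y
  proof -
    obtain n m where "x = restrict (coarsen n) (carrier Disc)" "y = restrict (coarsen m) (carrier Disc)"
      using \<open>x \<in> F\<close> \<open>y \<in> F\<close> by (auto simp: F_def)
    then show ?thesis
      using coarsen_antimono[of _ n "max n m"] coarsen_antimono[of _ m "max n m"]
      by (intro bexI[of _ "restrict (coarsen (max n m)) (carrier Disc)"])
         (simp_all add: le_fun_space F_def)
  qed
  then have "directed_in ?FS F" using F by (auto simp: directed_in_def F_def)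
  moreover have "\<forall>f\<in>F. finitely_separated Disc f"
    using finitely_separated_coarsen by (auto simp: F_def finitely_separated_def)
  moreover have "is_sup ?FS (restrict id (carrier Disc)) F"
    unfolding is_sup_iff[OF F]
  proof (intro conjI id ballI impI)
    show "x \<sqsubseteq>\<^bsub>?FS\<^esub> restrict id (carrier Disc)" if "x \<in> F" for x
    proof -
      obtain n where "x = restrict (coarsen n) (carrier Disc)" using \<open>x \<in> F\<close> by (auto simp: F_def)
      then show ?thesis by (simp add: le_fun_space coarsen_infl)
    qed
    show "restrict id (carrier Disc) \<sqsubseteq>\<^bsub>?FS\<^esub> u" if "\<forall>x\<in>F. x \<sqsubseteq>\<^bsub>?FS\<^esub> u" for u
      unfolding le_fun_space le_Disc
    proof
      fix x assume x: "x \<in> carrier Disc"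
      have "u x \<subseteq> coarsen n x" for n
      proof -
        have "restrict (coarsen n) (carrier Disc) \<sqsubseteq>\<^bsub>?FS\<^esub> u" using that by (simp add: F_def)
        then show ?thesis using x by (simp add: le_fun_space)
      qed
      then show "u x \<subseteq> restrict id (carrier Disc) x" using Inter_coarsen[OF x] x by simp
    qed
  qed
  ultimately show ?thesis unfolding FS_domain_def using domain_Disc by blast
qed

subsection \<open>Ideal completions\<close>

lemma scott_continuous_least:
  assumes f: "scott_continuous X Y f" and D: "directed_in X D" "is_sup X s D"
    and u: "u \<in> carrier Y" "\<And>x. x \<in> D \<Longrightarrow> f x \<sqsubseteq>\<^bsub>Y\<^esub> u"
  shows "f s \<sqsubseteq>\<^bsub>Y\<^esub> u"
proof -
  have "D \<subseteq> carrier X" using D(1) by (simp add: directed_in_def)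
  then have "f ` D \<subseteq> carrier Y" using scott_continuousD(1)[OF f] by blast
  then show ?thesis
    using scott_continuousD(3)[OF f D] u by (simp add: is_sup_iff)
qed

lemma directed_in_image:
  assumes f: "scott_continuous X Y f" and D: "directed_in X D"
  shows "directed_in Y (f ` D)"
proof -
  have sub: "D \<subseteq> carrier X" "D \<noteq> {}" and up: "\<And>x y. x \<in> D \<Longrightarrow> y \<in> D \<Longrightarrow> \<exists>z\<in>D. x \<sqsubseteq>\<^bsub>X\<^esub> z \<and> y \<sqsubseteq>\<^bsub>X\<^esub> z"
    using D by (simp_all add: directed_in_def)
  have "\<exists>k\<in>f ` D. f x \<sqsubseteq>\<^bsub>Y\<^esub> k \<and> f y \<sqsubseteq>\<^bsub>Y\<^esub> k" if xy: "x \<in> D" "y \<in> D" for x y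
  proof -
    obtain z where z: "z \<in> D" "x \<sqsubseteq>\<^bsub>X\<^esub> z \<and> y \<sqsubseteq>\<^bsub>X\<^esub> z" using up[OF xy] by (rule bexE)
    have car: "x \<in> carrier X" "y \<in> carrier X" "z \<in> carrier X"
      using xy z(1) by (auto intro: subsetD[OF sub(1)])
    have "f x \<sqsubseteq>\<^bsub>Y\<^esub> f z" "f y \<sqsubseteq>\<^bsub>Y\<^esub> f z"
      using z(2) scott_continuousD(2)[OF f car(1,3)] scott_continuousD(2)[OF f car(2,3)] by simp_all
    then show ?thesis using z(1) by blast
  qed
  moreover have "f ` D \<subseteq> carrier Y" using sub(1) scott_continuousD(1)[OF f] by blast
  ultimately show ?thesis using sub(2) by (simp add: directed_in_def)
qed

text \<open>\<open>P\<close> is ordered by inclusion. With codes in \<open>real^2\<close>, an ideal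
  has type \<open>disc_ambient\<close>.\<close>

definition ideals :: "'p set set \<Rightarrow> 'p set set set" where
  "ideals P = {I. I \<subseteq> P \<and> I \<noteq> {} \<and> (\<forall>A\<in>I. \<forall>B\<in>P. B \<subseteq> A \<longrightarrow> B \<in> I) \<and>
     (\<forall>A\<in>I. \<forall>B\<in>I. \<exists>C\<in>I. A \<subseteq> C \<and> B \<subseteq> C)}"

definition Idl :: "'p set set \<Rightarrow> 'p set set gorder" where
  "Idl P = \<lparr>carrier = ideals P, eq = (=), le = (\<subseteq>)\<rparr>"

text \<open>For \<open>A\<close> in \<open>P\<close> this is the principal ideal of
  \<open>A\<close>; these are the compact elements of the completion.\<close>

definition below :: "'p set set \<Rightarrow> 'p set \<Rightarrow> 'p set set" where
  "below P A = {B \<in> P. B \<subseteq> A}"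

lemma carrier_Idl [simp]: "carrier (Idl P) = ideals P"
  by (simp add: Idl_def)

lemma le_Idl [simp]: "I \<sqsubseteq>\<^bsub>Idl P\<^esub> J \<longleftrightarrow> I \<subseteq> J"
  by (simp add: Idl_def)

lemma partial_order_Idl: "partial_order (Idl P)"
  unfolding Idl_def by (rule partial_orderI_rel) auto

lemma idealsD:
  assumes "I \<in> ideals P"
  shows "I \<subseteq> P" "I \<noteq> {}" "\<And>A B. A \<in> I \<Longrightarrow> B \<in> P \<Longrightarrow> B \<subseteq> A \<Longrightarrow> B \<in> I"
    "\<And>A B. A \<in> I \<Longrightarrow> B \<in> I \<Longrightarrow> \<exists>C\<in>I. A \<subseteq> C \<and> B \<subseteq> C"
  using assms by (simp_all add: ideals_def)

lemma idealsI:
  assumes "I \<subseteq> P" "I \<noteq> {}" "\<And>A B. A \<in> I \<Longrightarrow> B \<in> P \<Longrightarrow> B \<subseteq> A \<Longrightarrow> B \<in> I"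
    "\<And>A B. A \<in> I \<Longrightarrow> B \<in> I \<Longrightarrow> \<exists>C\<in>I. A \<subseteq> C \<and> B \<subseteq> C"
  shows "I \<in> ideals P"
  using assms unfolding ideals_def by simp

lemma directed_IdlD:
  assumes "directed_in (Idl P) D"
  shows "D \<subseteq> ideals P" "D \<noteq> {}" "\<And>I J. I \<in> D \<Longrightarrow> J \<in> D \<Longrightarrow> \<exists>K\<in>D. I \<subseteq> K \<and> J \<subseteq> K"
  using assms by (simp_all add: directed_in_def)

lemma Union_directed_ideals:
  assumes D: "directed_in (Idl P) D"
  shows "\<Union>D \<in> ideals P"
proof (rule idealsI)
  note D = directed_IdlD[OF D]
  show "\<Union>D \<subseteq> P" using D(1) idealsD(1) by blast
  show "\<Union>D \<noteq> {}" using D(1,2) idealsD(2) by blast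
  show "B \<in> \<Union>D" if "A \<in> \<Union>D" "B \<in> P" "B \<subseteq> A" for A B
    using that D(1) idealsD(3) by blast
  show "\<exists>C\<in>\<Union>D. A \<subseteq> C \<and> B \<subseteq> C" if AB: "A \<in> \<Union>D" "B \<in> \<Union>D" for A B
  proof -
    obtain I J where "I \<in> D" "A \<in> I" "J \<in> D" "B \<in> J" using AB by blast
    then obtain K where "K \<in> D" "A \<in> K" "B \<in> K" using D(3) by blast
    then show ?thesis using idealsD(4)[of K P A B] D(1) by blast
  qed
qed

lemma is_sup_Idl:
  assumes D: "directed_in (Idl P) D"
  shows "is_sup (Idl P) s D \<longleftrightarrow> s = \<Union>D"
proof -
  have "D \<subseteq> carrier (Idl P)" "\<Union>D \<in> ideals P"
    using directed_IdlD(1)[OF D] Union_directed_ideals[OF D] by simp_all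
  show ?thesis
    unfolding is_sup_iff[OF \<open>D \<subseteq> carrier (Idl P)\<close>] le_Idl carrier_Idl
  proof
    assume *: "s \<in> ideals P \<and> (\<forall>x\<in>D. x \<subseteq> s) \<and> (\<forall>u\<in>ideals P. (\<forall>x\<in>D. x \<subseteq> u) \<longrightarrow> s \<subseteq> u)"
    then have "s \<subseteq> \<Union>D" using \<open>\<Union>D \<in> ideals P\<close> by (simp add: Sup_upper)
    moreover have "\<Union>D \<subseteq> s" using * by (simp add: Sup_least)
    ultimately show "s = \<Union>D" by (rule subset_antisym)
  qed (use \<open>\<Union>D \<in> ideals P\<close> in \<open>simp add: Sup_upper Sup_least\<close>)
qed

lemma below_ideal:
  assumes "A \<in> P"
  shows "below P A \<in> ideals P"
proof (rule idealsI)
  have A: "A \<in> below P A" using assms by (simp add: below_def)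
  then show "below P A \<noteq> {}" by blast
  show "\<exists>C\<in>below P A. B \<subseteq> C \<and> B' \<subseteq> C" if "B \<in> below P A" "B' \<in> below P A" for B B'
    using that A by (intro bexI[of _ A]) (simp_all add: below_def)
  show "below P A \<subseteq> P" by (simp add: below_def)
  show "B' \<in> below P A" if "B \<in> below P A" "B' \<in> P" "B' \<subseteq> B" for B B'
    using that unfolding below_def by blast
qed

lemma below_subset: "I \<in> ideals P \<Longrightarrow> A \<in> I \<Longrightarrow> below P A \<subseteq> I"
  using idealsD(3)[of I P A] unfolding below_def by blast

lemma self_in_below: "I \<in> ideals P \<Longrightarrow> A \<in> I \<Longrightarrow> A \<in> below P A"
  using idealsD(1)[of I P] unfolding below_def by blast

text \<open>One sandwich serves way-below, continuity and algebraicity: the principal ideals of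
  members of \<open>I\<close> are cofinal in \<open>S\<close>, and their union is
  \<open>I\<close>.\<close>

lemma approximants_Idl:
  assumes I: "I \<in> ideals P" and below: "below P ` I \<subseteq> S"
    and S: "S \<subseteq> {K \<in> ideals P. \<exists>A\<in>I. K \<subseteq> below P A}"
  shows "directed_in (Idl P) S \<and> is_sup (Idl P) I S"
proof (rule conjI)
  have SK: "\<exists>A\<in>I. K \<subseteq> below P A" if "K \<in> S" for K
    using subsetD[OF S \<open>K \<in> S\<close>] by simp
  have "\<exists>M\<in>S. K \<subseteq> M \<and> L \<subseteq> M" if KL: "K \<in> S" "L \<in> S" for K L
  proof -
    obtain A where A: "A \<in> I" "K \<subseteq> below P A" using SK[OF KL(1)] by (rule bexE)
    obtain B where B: "B \<in> I" "L \<subseteq> below P B" using SK[OF KL(2)] by (rule bexE)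
    obtain C where C: "C \<in> I" "A \<subseteq> C \<and> B \<subseteq> C" using idealsD(4)[OF I A(1) B(1)] by (rule bexE)
    then have "below P A \<subseteq> below P C" "below P B \<subseteq> below P C" unfolding below_def by blast+
    then have "K \<subseteq> below P C" "L \<subseteq> below P C" using A(2) B(2) by (simp_all only: order_trans)
    moreover have "below P C \<in> S" using C(1) by (intro subsetD[OF below] imageI)
    ultimately show ?thesis by blast
  qed
  moreover have "S \<noteq> {}" using below idealsD(2)[OF I] by blast
  moreover have "S \<subseteq> ideals P" using S by blast
  ultimately show dir: "directed_in (Idl P) S" by (simp add: directed_in_def)
  have "A \<in> \<Union>S" if "A \<in> I" for A
    using self_in_below[OF I that] subsetD[OF below imageI[OF that]] by (rule UnionI[rotated])
  then have "I \<subseteq> \<Union>S" by (rule subsetI)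
  moreover have "\<Union>S \<subseteq> I"
  proof (rule Union_least)
    fix K assume "K \<in> S"
    then obtain A where "A \<in> I" "K \<subseteq> below P A" by (elim bexE[OF SK])
    then show "K \<subseteq> I" using below_subset[OF I] by (meson order_trans)
  qed
  ultimately show "is_sup (Idl P) I S" unfolding is_sup_Idl[OF dir] by (rule subset_antisym)
qed

lemma way_below_Idl:
  "way_below (Idl P) I J \<longleftrightarrow> I \<in> ideals P \<and> J \<in> ideals P \<and> (\<exists>A\<in>J. I \<subseteq> below P A)"
proof
  assume wb: "way_below (Idl P) I J"
  then have IJ: "I \<in> ideals P" "J \<in> ideals P" by (simp_all add: way_below_def)
  have "below P ` J \<subseteq> {K \<in> ideals P. \<exists>A\<in>J. K \<subseteq> below P A}"
    using below_ideal idealsD(1)[OF IJ(2)] by blast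
  then have "directed_in (Idl P) (below P ` J)" "is_sup (Idl P) J (below P ` J)" "J \<sqsubseteq>\<^bsub>Idl P\<^esub> J"
    using approximants_Idl[OF IJ(2) subset_refl] by simp_all
  then have "\<exists>d\<in>below P ` J. I \<sqsubseteq>\<^bsub>Idl P\<^esub> d" using wb unfolding way_below_def by blast
  then show "I \<in> ideals P \<and> J \<in> ideals P \<and> (\<exists>A\<in>J. I \<subseteq> below P A)" using IJ by simp
next
  assume *: "I \<in> ideals P \<and> J \<in> ideals P \<and> (\<exists>A\<in>J. I \<subseteq> below P A)"
  then obtain A where A: "A \<in> J" "I \<subseteq> below P A" by blast
  have "\<exists>d\<in>D. I \<subseteq> d" if D: "directed_in (Idl P) D" "is_sup (Idl P) s D" "J \<subseteq> s" for D s
  proof -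
    have "s = \<Union>D" using D(2) is_sup_Idl[OF D(1)] by simp
    then obtain d where d: "d \<in> D" "A \<in> d" using A D(3) by blast
    then have "below P A \<subseteq> d" using directed_IdlD(1)[OF D(1)] below_subset by blast
    then show ?thesis using A d by blast
  qed
  then show "way_below (Idl P) I J" using * by (simp add: way_below_def)
qed

lemma pointed_algebraic_Idl:
  assumes "{} \<in> P"
  shows "pointed (Idl P)" "algebraic_domain (Idl P)"
proof -
  have bot: "{{}} \<in> ideals P" using assms by (intro idealsI) auto
  have "{{}} \<subseteq> I" if I: "I \<in> ideals P" for I
  proof -
    obtain A where "A \<in> I" using idealsD(2)[OF I] by blast
    then show ?thesis using idealsD(3)[OF I _ assms] by blast
  qed
  then show "pointed (Idl P)"
    using bot unfolding pointed_def least_def by (intro exI[of _ "{{}}"]) simp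
  have "continuous_poset (Idl P)"
    unfolding continuous_poset_def carrier_Idl
  proof
    fix I assume I: "I \<in> ideals P"
    then have "below P ` I \<subseteq> {J. way_below (Idl P) J I}"
      using below_ideal idealsD(1)[OF I] by (auto simp: way_below_Idl)
    then show "directed_in (Idl P) {J. way_below (Idl P) J I} \<and> is_sup (Idl P) I {J. way_below (Idl P) J I}"
      by (rule approximants_Idl[OF I]) (auto simp: way_below_Idl)
  qed
  moreover have "algebraic_poset (Idl P)"
    unfolding algebraic_poset_def carrier_Idl le_Idl
  proof
    fix I assume I: "I \<in> ideals P"
    show "directed_in (Idl P) {k. compact_element (Idl P) k \<and> k \<subseteq> I} \<and>
        is_sup (Idl P) I {k. compact_element (Idl P) k \<and> k \<subseteq> I}"
    proof (rule approximants_Idl[OF I])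
      show "below P ` I \<subseteq> {k. compact_element (Idl P) k \<and> k \<subseteq> I}"
      proof clarify
        fix A assume A: "A \<in> I"
        then have "below P A \<in> ideals P" using below_ideal idealsD(1)[OF I] by blast
        then have "compact_element (Idl P) (below P A)"
          unfolding compact_element_def way_below_Idl using self_in_below[OF I A] by blast
        then show "compact_element (Idl P) (below P A) \<and> below P A \<subseteq> I"
          using below_subset[OF I A] by simp
      qed
      show "{k. compact_element (Idl P) k \<and> k \<subseteq> I} \<subseteq> {K \<in> ideals P. \<exists>A\<in>I. K \<subseteq> below P A}"
        unfolding compact_element_def way_below_Idl by blast
    qed
  qed
  moreover have "\<exists>s. is_sup (Idl P) s D" if "directed_in (Idl P) D" for D
    using is_sup_Idl[OF that] by blast
  moreover have "ideals P \<noteq> {}" using bot by blast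
  ultimately show "algebraic_domain (Idl P)"
    using partial_order_Idl by (simp add: algebraic_domain_def domain_poset_def dcpo_def)
qed

text \<open>Such an ideal is a finite directed family and so has a largest member. A value that uses
  finitely many codes is therefore a principal ideal.\<close>

lemma ideal_Union_mem:
  assumes I: "I \<in> ideals P" and fin: "finite (\<Union>I)"
  shows "\<Union>I \<in> I"
proof -
  have *: "\<exists>C\<in>I. \<forall>A\<in>F. A \<subseteq> C" if "finite F" "F \<subseteq> I" for F
    using that
  proof (induction F)
    case empty
    then show ?case using idealsD(2)[OF I] by blast
  next
    case (insert A F)
    have "\<exists>C\<in>I. \<forall>B\<in>F. B \<subseteq> C" using insert.IH insert.prems by simp
    then obtain C where C: "C \<in> I" "\<forall>B\<in>F. B \<subseteq> C" by blast
    moreover have "A \<in> I" using insert.prems by simp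
    ultimately obtain D where "D \<in> I" "A \<subseteq> D" "C \<subseteq> D" using idealsD(4)[OF I] by blast
    then show ?case using C by blast
  qed
  have "finite I" using fin by (rule finite_UnionD)
  then have "\<exists>C\<in>I. \<forall>A\<in>I. A \<subseteq> C" by (rule *) simp
  then obtain C where "C \<in> I" "\<forall>A\<in>I. A \<subseteq> C" by blast
  then have "\<Union>I = C" by blast
  then show ?thesis using \<open>C \<in> I\<close> by simp
qed

section \<open>Directed suprema of maps into an ideal completion\<close>

lemma directed_fun_space_values:
  assumes W: "directed_in (fun_space X (Idl P)) W" and x: "x \<in> carrier X"
  shows "directed_in (Idl P) ((\<lambda>f. f x) ` W)"
proof -
  have "W \<subseteq> carrier (fun_space X (Idl P))" "W \<noteq> {}" using W by (simp_all add: directed_in_def)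
  moreover have "\<exists>K\<in>(\<lambda>f. f x) ` W. I \<subseteq> K \<and> J \<subseteq> K" if IJ: "I \<in> (\<lambda>f. f x) ` W" "J \<in> (\<lambda>f. f x) ` W" for I J
  proof -
    obtain f g where fg: "f \<in> W" "g \<in> W" "I = f x" "J = g x" using IJ by blast
    then obtain h where "h \<in> W" "f \<sqsubseteq>\<^bsub>fun_space X (Idl P)\<^esub> h" "g \<sqsubseteq>\<^bsub>fun_space X (Idl P)\<^esub> h"
      using W unfolding directed_in_def by blast
    then have "f x \<subseteq> h x" "g x \<subseteq> h x" using x by (simp_all add: le_fun_space)
    then show ?thesis using fg \<open>h \<in> W\<close> by blast
  qed
  moreover have "f x \<in> ideals P" if "f \<in> W" for f
  proof -
    have "f \<in> carrier (fun_space X (Idl P))" using \<open>f \<in> W\<close> W by (auto simp: directed_in_def)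
    then have "scott_continuous X (Idl P) f" by (simp add: carrier_fun_space)
    from scott_continuousD(1)[OF this x] show ?thesis by simp
  qed
  then have "(\<lambda>f. f x) ` W \<subseteq> ideals P" by blast
  ultimately show ?thesis unfolding directed_in_def carrier_Idl le_Idl by blast
qed

lemma fun_space_Union:
  assumes X: "partial_order X" and W: "directed_in (fun_space X (Idl P)) W"
  shows "restrict (\<lambda>x. \<Union>f\<in>W. f x) (carrier X) \<in> carrier (fun_space X (Idl P))"
proof (rule scott_continuous_restrict[OF X], rule scott_continuousI[OF X partial_order_Idl])
  have sc: "scott_continuous X (Idl P) f" if "f \<in> W" for f
  proof -
    have "f \<in> carrier (fun_space X (Idl P))" using \<open>f \<in> W\<close> W by (auto simp: directed_in_def)
    then show ?thesis by (simp add: carrier_fun_space)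
  qed
  show "(\<Union>f\<in>W. f x) \<in> carrier (Idl P)" if "x \<in> carrier X" for x
    using Union_directed_ideals[OF directed_fun_space_values[OF W \<open>x \<in> carrier X\<close>]] by simp
  show "(\<Union>f\<in>W. f x) \<sqsubseteq>\<^bsub>Idl P\<^esub> (\<Union>f\<in>W. f y)"
    if "x \<in> carrier X" "y \<in> carrier X" "x \<sqsubseteq>\<^bsub>X\<^esub> y" for x y
  proof -
    have "f x \<subseteq> f y" if "f \<in> W" for f
      using scott_continuousD(2)[OF sc[OF \<open>f \<in> W\<close>] \<open>x \<in> carrier X\<close> \<open>y \<in> carrier X\<close> \<open>x \<sqsubseteq>\<^bsub>X\<^esub> y\<close>] by simp
    then show ?thesis by (simp add: UN_mono)
  qed
  show "(\<Union>f\<in>W. f s) \<sqsubseteq>\<^bsub>Idl P\<^esub> u"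
    if D: "directed_in X D" "is_sup X s D" and u: "u \<in> carrier (Idl P)"
      and ub: "\<And>x. x \<in> D \<Longrightarrow> (\<Union>f\<in>W. f x) \<sqsubseteq>\<^bsub>Idl P\<^esub> u" for D s u
  proof -
    have "f s \<subseteq> u" if "f \<in> W" for f
    proof -
      have "f x \<sqsubseteq>\<^bsub>Idl P\<^esub> u" if "x \<in> D" for x
        using ub[OF \<open>x \<in> D\<close>] \<open>f \<in> W\<close> by (simp add: UN_subset_iff)
      then show ?thesis using scott_continuous_least[OF sc[OF \<open>f \<in> W\<close>] D u] by simp
    qed
    then show ?thesis by (simp add: UN_subset_iff)
  qed
qed

text \<open>The pointwise union is itself Scott continuous, so the supremum cannot exceed it. Thus
  every element of a value of the supremum already occurs in the value of some map of the
  family.\<close>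

lemma is_sup_fun_space_pointwise:
  assumes X: "partial_order X" and W: "directed_in (fun_space X (Idl P)) W"
    and T: "is_sup (fun_space X (Idl P)) T W" and x: "x \<in> carrier X"
  shows "T x \<subseteq> (\<Union>f\<in>W. f x)"
proof -
  define h where "h = restrict (\<lambda>x. \<Union>f\<in>W. f x) (carrier X)"
  have h: "h \<in> carrier (fun_space X (Idl P))" unfolding h_def by (rule fun_space_Union[OF X W])
  have "f \<sqsubseteq>\<^bsub>fun_space X (Idl P)\<^esub> h" if "f \<in> W" for f
    using that by (auto simp: le_fun_space h_def)
  moreover have "W \<subseteq> carrier (fun_space X (Idl P))" using W by (simp add: directed_in_def)
  ultimately have "T \<sqsubseteq>\<^bsub>fun_space X (Idl P)\<^esub> h" using T h by (simp add: is_sup_iff)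
  then have "T x \<subseteq> h x" using x by (simp add: le_fun_space)
  also have "h x = (\<Union>f\<in>W. f x)" using x by (simp add: h_def)
  finally show ?thesis .
qed

subsection \<open>Monotone maps with finitely many values are not close to the identity\<close>

text \<open>Each diagonal difference is a sum of two axis-parallel ones. These telescope along
  \<open>n + m\<close> lines, and every line costs one boundary term of at most
  \<open>\<epsilon>\<close>, whereas a cellwise estimate would cost \<open>n * m\<close> of
  them.\<close>

lemma null_telescope:
  fixes G :: "nat \<Rightarrow> nat \<Rightarrow> real"
  assumes "\<And>i l. i \<le> n \<Longrightarrow> l \<le> m \<Longrightarrow> 0 \<le> G i l \<and> G i l \<le> \<epsilon>"
  shows "(\<Sum>i<n. \<Sum>l<m. G i (Suc l) - G (Suc i) l) \<le> \<epsilon> * (n + m)"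
    and "(\<Sum>i<n. \<Sum>l<m. G (Suc i) (Suc l) - G i l) \<le> \<epsilon> * (n + m)"
proof -
  have bd: "G i l - G i' l' \<le> \<epsilon>" if "i \<le> n" "l \<le> m" "i' \<le> n" "l' \<le> m" for i l i' l'
    using assms[of i l] assms[of i' l'] that by linarith
  have "(\<Sum>i<n. \<Sum>l<m. G i (Suc l) - G (Suc i) l)
      = (\<Sum>i<n. \<Sum>l<m. G i (Suc l) - G i l) + (\<Sum>l<m. \<Sum>i<n. G i l - G (Suc i) l)"
    unfolding sum.swap[of _ "{..<m}"] by (simp flip: sum.distrib)
  also have "\<dots> = (\<Sum>i<n. G i m - G i 0) + (\<Sum>l<m. G 0 l - G n l)"
    using sum_lessThan_telescope[of "\<lambda>l. G _ l" m] sum_lessThan_telescope'[of "\<lambda>i. G i _" n] by simp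
  also have "\<dots> \<le> (\<Sum>i<n. \<epsilon>) + (\<Sum>l<m. \<epsilon>)"
    by (intro add_mono sum_mono bd) auto
  finally show "(\<Sum>i<n. \<Sum>l<m. G i (Suc l) - G (Suc i) l) \<le> \<epsilon> * (n + m)"
    by (simp add: algebra_simps)
  have "(\<Sum>i<n. \<Sum>l<m. G (Suc i) (Suc l) - G i l)
      = (\<Sum>i<n. \<Sum>l<m. G i (Suc l) - G i l) + (\<Sum>l<m. \<Sum>i<n. G (Suc i) (Suc l) - G i (Suc l))"
    unfolding sum.swap[of _ "{..<m}"] by (simp flip: sum.distrib)
  also have "\<dots> = (\<Sum>i<n. G i m - G i 0) + (\<Sum>l<m. G n (Suc l) - G 0 (Suc l))"
    using sum_lessThan_telescope[of "\<lambda>l. G _ l" m] sum_lessThan_telescope[of "\<lambda>i. G i (Suc _)" n] by simp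
  also have "\<dots> \<le> (\<Sum>i<n. \<epsilon>) + (\<Sum>l<m. \<epsilon>)"
    by (intro add_mono sum_mono bd) auto
  finally show "(\<Sum>i<n. \<Sum>l<m. G (Suc i) (Suc l) - G i l) \<le> \<epsilon> * (n + m)"
    by (simp add: algebra_simps)
qed

text \<open>In each double step \<open>f\<close> contributes the second half and \<open>g\<close>
  the first; the halves left out are nonnegative.\<close>

lemma sum_alternate_le:
  fixes f g :: "nat \<Rightarrow> real"
  assumes "\<And>l. l < 2 * N \<Longrightarrow> 0 \<le> f l" "\<And>l. l < 2 * N \<Longrightarrow> 0 \<le> g l"
  shows "(\<Sum>l<N. f (2 * l + 1) + g (2 * l)) \<le> (\<Sum>l<2*N. f l + g l)"
  using assms
proof (induction N)
  case (Suc N)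
  have "(\<Sum>l<N. f (2 * l + 1) + g (2 * l)) \<le> (\<Sum>l<2*N. f l + g l)"
    using Suc.prems by (intro Suc.IH) auto
  then show ?case using Suc.prems[of "2*N"] Suc.prems[of "2*N+1"] by simp
qed simp

text \<open>In use, \<open>S\<close> and \<open>D\<close> are the support functions of the assigned
  disks in two opposite axis directions. The terms with factor \<open>k\<close> are their values for
  the identity, which are constant along the null steps; after subtracting them only errors between
  0 and \<open>\<epsilon>\<close> remain for \<open>null_telescope\<close>.\<close>

lemma null_drop_sum:
  fixes S D :: "nat \<Rightarrow> nat \<Rightarrow> real"
  assumes S: "\<And>i l. i \<le> n \<Longrightarrow> l \<le> n \<Longrightarrow> k * (real l + real i) \<le> S i l \<and> S i l \<le> k * (real l + real i) + \<epsilon>"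
    and D: "\<And>i l. i \<le> n \<Longrightarrow> l \<le> n \<Longrightarrow> k * (real l - real i) \<le> D i l \<and> D i l \<le> k * (real l - real i) + \<epsilon>"
    and S_mono: "\<And>i l. i < n \<Longrightarrow> l < n \<Longrightarrow> S (Suc i) l \<le> S i (Suc l)"
    and D_mono: "\<And>i l. i < n \<Longrightarrow> l < n \<Longrightarrow> D i l \<le> D (Suc i) (Suc l)"
    and n: "n = 2 * N"
  shows "(\<Sum>i<n. \<Sum>l<N. (S i (2 * l + 2) - S (Suc i) (2 * l + 1)) + (D (Suc i) (2 * l + 1) - D i (2 * l)))
           \<le> 4 * \<epsilon> * n"
proof -
  have "(\<Sum>i<n. \<Sum>l<N. (S i (2 * l + 2) - S (Suc i) (2 * l + 1)) + (D (Suc i) (2 * l + 1) - D i (2 * l)))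
      \<le> (\<Sum>i<n. \<Sum>l<n. (S i (Suc l) - S (Suc i) l) + (D (Suc i) (Suc l) - D i l))"
  proof (rule sum_mono)
    fix i assume "i \<in> {..<n}"
    then have "i < n" by simp
    show "(\<Sum>l<N. (S i (2 * l + 2) - S (Suc i) (2 * l + 1)) + (D (Suc i) (2 * l + 1) - D i (2 * l)))
       \<le> (\<Sum>l<n. (S i (Suc l) - S (Suc i) l) + (D (Suc i) (Suc l) - D i l))"
      using sum_alternate_le[of N "\<lambda>l. S i (Suc l) - S (Suc i) l" "\<lambda>l. D (Suc i) (Suc l) - D i l"]
        S_mono[OF \<open>i < n\<close>] D_mono[OF \<open>i < n\<close>] n by simp
  qed
  also have "\<dots> = (\<Sum>i<n. \<Sum>l<n. S i (Suc l) - S (Suc i) l) + (\<Sum>i<n. \<Sum>l<n. D (Suc i) (Suc l) - D i l)"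
    by (simp add: sum.distrib)
  also have "\<dots> = (\<Sum>i<n. \<Sum>l<n. (S i (Suc l) - k * (real (Suc l) + real i)) - (S (Suc i) l - k * (real l + real (Suc i))))
     + (\<Sum>i<n. \<Sum>l<n. (D (Suc i) (Suc l) - k * (real (Suc l) - real (Suc i))) - (D i l - k * (real l - real i)))"
    by (intro arg_cong2[where f = "(+)"] sum.cong refl) (auto simp: algebra_simps)
  also have "\<dots> \<le> \<epsilon> * (n + n) + \<epsilon> * (n + n)"
    by (intro add_mono null_telescope[of n n "\<lambda>i l. S i l - k * (real l + real i)" \<epsilon>]
          null_telescope[of n n "\<lambda>i l. D i l - k * (real l - real i)" \<epsilon>])
       (use S D in \<open>auto simp: algebra_simps\<close>)
  finally show ?thesis by (simp add: algebra_simps)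
qed

text \<open>\<open>(X, Y)\<close> and \<open>R\<close> are the centre and the radius of the disk assigned to the disk of radius
  \<open>k * l\<close> around the grid point \<open>k * (i, j)\<close>. A column \<open>(i, j)\<close> is good if the radius drop of each of its
  vertical double steps is controlled by the drops along the null steps through the two neighbouring
  columns. The sum of all null drops telescopes, the sum of the vertical drops is large.\<close>

lemma few_good_columns:
  fixes X Y R :: "nat \<Rightarrow> nat \<Rightarrow> nat \<Rightarrow> real"
  assumes XS: "\<And>i j l. i \<le> n \<Longrightarrow> j \<le> n \<Longrightarrow> l \<le> n \<Longrightarrow>
        k * (real l + real i) \<le> R i j l + X i j l \<and> R i j l + X i j l \<le> k * (real l + real i) + \<epsilon>"
    and XD: "\<And>i j l. i \<le> n \<Longrightarrow> j \<le> n \<Longrightarrow> l \<le> n \<Longrightarrow>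
        k * (real l - real i) \<le> R i j l - X i j l \<and> R i j l - X i j l \<le> k * (real l - real i) + \<epsilon>"
    and YS: "\<And>i j l. i \<le> n \<Longrightarrow> j \<le> n \<Longrightarrow> l \<le> n \<Longrightarrow>
        k * (real l + real j) \<le> R i j l + Y i j l \<and> R i j l + Y i j l \<le> k * (real l + real j) + \<epsilon>"
    and YD: "\<And>i j l. i \<le> n \<Longrightarrow> j \<le> n \<Longrightarrow> l \<le> n \<Longrightarrow>
        k * (real l - real j) \<le> R i j l - Y i j l \<and> R i j l - Y i j l \<le> k * (real l - real j) + \<epsilon>"
    and XS_mono: "\<And>i j l. i < n \<Longrightarrow> j < n \<Longrightarrow> l < n \<Longrightarrow>
        R (Suc i) j l + X (Suc i) j l \<le> R i j (Suc l) + X i j (Suc l)"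
    and XD_mono: "\<And>i j l. i < n \<Longrightarrow> j < n \<Longrightarrow> l < n \<Longrightarrow>
        R i j l - X i j l \<le> R (Suc i) j (Suc l) - X (Suc i) j (Suc l)"
    and YS_mono: "\<And>i j l. i < n \<Longrightarrow> j < n \<Longrightarrow> l < n \<Longrightarrow>
        R i (Suc j) l + Y i (Suc j) l \<le> R i j (Suc l) + Y i j (Suc l)"
    and YD_mono: "\<And>i j l. i < n \<Longrightarrow> j < n \<Longrightarrow> l < n \<Longrightarrow>
        R i j l - Y i j l \<le> R i (Suc j) (Suc l) - Y i (Suc j) (Suc l)"
    and good: "good \<subseteq> {..<n} \<times> {..<n}"
      "\<And>i j l. (i, j) \<in> good \<Longrightarrow> l < N \<Longrightarrow>
        R i j (2 * l + 2) - R i j (2 * l) \<le> 2 * (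
          ((R i j (2 * l + 2) + X i j (2 * l + 2)) - (R (Suc i) j (2 * l + 1) + X (Suc i) j (2 * l + 1)))
        + ((R (Suc i) j (2 * l + 1) - X (Suc i) j (2 * l + 1)) - (R i j (2 * l) - X i j (2 * l)))
        + (((R i j (2 * l + 2) + Y i j (2 * l + 2)) - (R i (Suc j) (2 * l + 1) + Y i (Suc j) (2 * l + 1)))
        + ((R i (Suc j) (2 * l + 1) - Y i (Suc j) (2 * l + 1)) - (R i j (2 * l) - Y i j (2 * l)))))"
    and n: "n = 2 * N"
  shows "real (card good) * (k * n - \<epsilon>) \<le> 16 * \<epsilon> * (real n)\<^sup>2"
proof -
  define A where "A i j l = ((R i j (2 * l + 2) + X i j (2 * l + 2)) - (R (Suc i) j (2 * l + 1) + X (Suc i) j (2 * l + 1)))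
        + ((R (Suc i) j (2 * l + 1) - X (Suc i) j (2 * l + 1)) - (R i j (2 * l) - X i j (2 * l)))" for i j l
  define B where "B i j l = ((R i j (2 * l + 2) + Y i j (2 * l + 2)) - (R i (Suc j) (2 * l + 1) + Y i (Suc j) (2 * l + 1)))
        + ((R i (Suc j) (2 * l + 1) - Y i (Suc j) (2 * l + 1)) - (R i j (2 * l) - Y i j (2 * l)))" for i j l
  have A_sum: "(\<Sum>i<n. \<Sum>l<N. A i j l) \<le> 4 * \<epsilon> * n" if "j < n" for j
    unfolding A_def
    by (rule null_drop_sum[where k = k and S = "\<lambda>i l. R i j l + X i j l" and D = "\<lambda>i l. R i j l - X i j l"])
       (use that XS[of _ j] XD[of _ j] XS_mono[of _ j] XD_mono[of _ j] n in auto)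
  have B_sum: "(\<Sum>j<n. \<Sum>l<N. B i j l) \<le> 4 * \<epsilon> * n" if "i < n" for i
    unfolding B_def
    by (rule null_drop_sum[where k = k and S = "\<lambda>j l. R i j l + Y i j l" and D = "\<lambda>j l. R i j l - Y i j l"])
       (use that YS[of i] YD[of i] YS_mono[of i] YD_mono[of i] n in auto)
  have A0: "0 \<le> A i j l" if "i < n" "j < n" "l < N" for i j l
    using XS_mono[of i j "2*l+1"] XD_mono[of i j "2*l"] that n by (simp add: A_def)
  have B0: "0 \<le> B i j l" if "i < n" "j < n" "l < N" for i j l
    using YS_mono[of i j "2*l+1"] YD_mono[of i j "2*l"] that n by (simp add: B_def)
  have "real (card good) * (k * n - \<epsilon>) = (\<Sum>(i,j)\<in>good. k * n - \<epsilon>)" by simp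
  also have "\<dots> \<le> (\<Sum>(i,j)\<in>good. 2 * (\<Sum>l<N. A i j l + B i j l))"
  proof (rule sum_mono, clarify)
    fix i j assume ij: "(i, j) \<in> good"
    then have lt: "i < n" "j < n" using good(1) by auto
    \<comment> \<open>\<open>R\<close> is the mean of \<open>R + X\<close> and \<open>R - X\<close>,
      hence lies between \<open>k * l\<close> and \<open>k * l + \<epsilon>\<close>.\<close>
    have "k * n - \<epsilon> \<le> R i j n - R i j 0"
      using XS[of i j n] XD[of i j n] XS[of i j 0] XD[of i j 0] lt by (simp add: algebra_simps)
    also have "\<dots> = (\<Sum>l<N. R i j (2 * Suc l) - R i j (2 * l))"
      using sum_lessThan_telescope[of "\<lambda>l. R i j (2 * l)" N] n by simp
    also have "\<dots> \<le> (\<Sum>l<N. 2 * (A i j l + B i j l))"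
      using good(2)[OF ij] by (intro sum_mono) (simp add: A_def B_def)
    finally show "k * n - \<epsilon> \<le> 2 * (\<Sum>l<N. A i j l + B i j l)" by (simp add: sum_distrib_left)
  qed
  also have "\<dots> \<le> (\<Sum>(i,j)\<in>{..<n}\<times>{..<n}. 2 * (\<Sum>l<N. A i j l + B i j l))"
    using good(1) A0 B0 by (intro sum_mono2) (auto intro!: sum_nonneg add_nonneg_nonneg)
  also have "\<dots> = 2 * ((\<Sum>j<n. \<Sum>i<n. \<Sum>l<N. A i j l) + (\<Sum>i<n. \<Sum>j<n. \<Sum>l<N. B i j l))"
    by (simp add: sum.cartesian_product[symmetric] sum.distrib sum_distrib_left[symmetric])
       (rule sum.swap)
  \<comment> \<open>The factor 16 arises as 2 times two axes times 4, with \<open>n\<close> slices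
    per axis.\<close>
  also have "\<dots> \<le> 2 * ((\<Sum>j<n. 4 * \<epsilon> * n) + (\<Sum>i<n. 4 * \<epsilon> * n))"
    using A_sum B_sum by (intro mult_left_mono add_mono sum_mono) auto
  finally show ?thesis by (simp add: power2_eq_square algebra_simps)
qed

section \<open>Lebesgue measure and the position of the grid\<close>

definition pt :: "nat \<Rightarrow> nat \<Rightarrow> real^2" where
  "pt i j = vector [real i, real j]"

lemma pt_nth [simp]: "pt i j $ 1 = real i" "pt i j $ 2 = real j"
  by (simp_all add: pt_def)

lemma emeasure_box_vec:
  assumes "0 \<le> k"
  shows "emeasure lborel (box 0 (vec k) :: (real^2) set) = ennreal (k\<^sup>2)"
proof -
  have *: "vec k \<bullet> b = k" if "b \<in> Basis" for b :: "real^2"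
    using that by (auto simp: Basis_vec_def inner_axis)
  then have "emeasure lborel (box 0 (vec k) :: (real^2) set) = (\<Prod>b\<in>(Basis :: (real^2) set). k)"
    using assms by (subst emeasure_lborel_box) (auto intro!: arg_cong[where f = ennreal] prod.cong)
  then show ?thesis by simp
qed

text \<open>Average over the offset \<open>p\<close> in one cell. By translation invariance the
  integral of the count is the measure of the part of \<open>Z\<close> in the disjoint translated
  cells, all inside the box of side 2. A count of at least \<open>n^2 / 4\<close> for every
  \<open>p\<close> would make it at least 1/4, since the cell has area \<open>k^2\<close> and
  \<open>k * n = 1\<close>.\<close>

lemma grid_average:
  fixes Z :: "(real^2) set"
  assumes Z: "Z \<in> sets borel" and n: "0 < n" and k: "k = 1 / real n"
    and small: "emeasure lborel (Z \<inter> cbox 0 (vec 2)) < ennreal (1/4)"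
  obtains p where "p \<in> box 0 (vec k)"
    "card {(i, j) \<in> {..n} \<times> {..n}. p + k *\<^sub>R pt i j \<in> Z} < (real n)\<^sup>2 / 4"
proof (rule ccontr)
  assume "\<not> thesis"
  then have no: "\<And>p. p \<in> box 0 (vec k) \<Longrightarrow>
      \<not> card {(i, j) \<in> {..n} \<times> {..n}. p + k *\<^sub>R pt i j \<in> Z} < (real n)\<^sup>2 / 4"
    using that by blast
  define I where "I = {..n} \<times> {..n}"
  define w where "w = (\<lambda>(i, j). k *\<^sub>R pt i j)"
  define cell where "cell = (box 0 (vec k) :: (real^2) set)"
  have I: "finite I" by (simp add: I_def)
  have k0: "0 < k" "k \<le> 1" "k * n = 1" unfolding k using n by auto
  have many: "real n ^ 2 / 4 \<le> card {v \<in> I. p + w v \<in> Z}" if "p \<in> cell" for p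
  proof -
    have "{(i, j) \<in> {..n} \<times> {..n}. p + k *\<^sub>R pt i j \<in> Z} = {v \<in> I. p + w v \<in> Z}"
      by (auto simp: I_def w_def)
    then show ?thesis
      using no[OF that[unfolded cell_def]] by simp
  qed
  define T where "T v = Z \<inter> box (w v) (w v + vec k)" for v
  have T: "T v \<in> sets borel" for v using Z by (auto simp: T_def)
  have pre: "(+) (w v) -` T v = {p \<in> cell. p + w v \<in> Z}" for v
    by (auto simp: T_def cell_def mem_box_cart add.commute)
  have Tm: "emeasure lborel {p \<in> cell. p + w v \<in> Z} = emeasure lborel (T v)" for v
    using T[of v] by (subst lborel_distr_plus[of "w v", symmetric]) (simp add: emeasure_distr pre)
  have Tb: "{p \<in> cell. p + w v \<in> Z} \<in> sets borel" for v
    using measurable_sets[of "(+) (w v)" borel borel "T v"] T[of v] by (simp add: pre)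
  have disj: "disjoint_family_on T I"
    unfolding disjoint_family_on_def
  proof (intro ballI impI, rule ccontr)
    fix u v assume "u \<in> I" "v \<in> I" "u \<noteq> v" "T u \<inter> T v \<noteq> {}"
    then obtain x i j i' j' where x: "x \<in> T u" "x \<in> T v" "u = (i, j)" "v = (i', j')" by (metis IntE ex_in_conv surj_pair)
    have "i = i' \<and> j = j'"
    proof -
      have "k * i < x $ 1" "x $ 1 < k * (i + 1)" "k * i' < x $ 1" "x $ 1 < k * (i' + 1)"
        "k * j < x $ 2" "x $ 2 < k * (j + 1)" "k * j' < x $ 2" "x $ 2 < k * (j' + 1)"
        using x by (auto simp: T_def w_def mem_box_cart forall_2 algebra_simps)
      then have "k * i < k * (i' + 1)" "k * i' < k * (i + 1)" "k * j < k * (j' + 1)" "k * j' < k * (j + 1)"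
        by linarith+
      then show ?thesis using k0 by simp
    qed
    then show False using x \<open>u \<noteq> v\<close> by simp
  qed
  have sub: "T v \<subseteq> Z \<inter> cbox 0 (vec 2)" if "v \<in> I" for v
  proof
    fix x assume x: "x \<in> T v"
    obtain i j where v: "v = (i, j)" "i \<le> n" "j \<le> n" using \<open>v \<in> I\<close> by (auto simp: I_def)
    have "k * i \<le> k * n" "k * j \<le> k * n" "0 \<le> k * i" "0 \<le> k * j" using v k0(1) by auto
    moreover have "k * i < x $ 1" "x $ 1 < k * i + k" "k * j < x $ 2" "x $ 2 < k * j + k"
      using x v by (auto simp: T_def w_def mem_box_cart forall_2)
    ultimately have "0 \<le> x $ 1" "x $ 1 \<le> 2" "0 \<le> x $ 2" "x $ 2 \<le> 2"
      using k0 by linarith+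
    then show "x \<in> Z \<inter> cbox 0 (vec 2)" using x by (auto simp: T_def mem_box_cart forall_2)
  qed
  have "ennreal (1/4) = ennreal (n ^ 2 / 4) * emeasure lborel cell"
    using k0 unfolding cell_def
    by (subst emeasure_box_vec) (auto simp: ennreal_mult[symmetric] field_simps power_mult_distrib[symmetric])
  also have "\<dots> = (\<integral>\<^sup>+p. ennreal (n ^ 2 / 4) * indicator cell p \<partial>lborel)"
    by (simp add: nn_integral_cmult_indicator cell_def)
  also have "\<dots> \<le> (\<integral>\<^sup>+p. (\<Sum>v\<in>I. indicator {p \<in> cell. p + w v \<in> Z} p) \<partial>lborel)"
  proof (rule nn_integral_mono)
    fix p :: "real^2"
    show "ennreal (n ^ 2 / 4) * indicator cell p \<le> (\<Sum>v\<in>I. indicator {p \<in> cell. p + w v \<in> Z} p)"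
    proof (cases "p \<in> cell")
      case True
      have "(\<Sum>v\<in>I. indicator {p \<in> cell. p + w v \<in> Z} p) = (\<Sum>v\<in>I. if p + w v \<in> Z then 1 else 0 :: ennreal)"
        using True by (intro sum.cong) (auto simp: indicator_def)
      also have "\<dots> = of_nat (card {v \<in> I. p + w v \<in> Z})"
        using I by (simp add: sum.If_cases Int_def)
      finally show ?thesis using many[OF True] True
        by (simp add: ennreal_of_nat_eq_real_of_nat ennreal_leI)
    qed simp
  qed
  also have "\<dots> = (\<Sum>v\<in>I. emeasure lborel {p \<in> cell. p + w v \<in> Z})"
    using Tb by (subst nn_integral_sum) auto
  also have "\<dots> = (\<Sum>v\<in>I. emeasure lborel (T v))" by (simp add: Tm)
  also have "\<dots> = emeasure lborel (\<Union>v\<in>I. T v)"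
    using T disj I by (intro sum_emeasure) auto
  also have "\<dots> \<le> emeasure lborel (Z \<inter> cbox 0 (vec 2))"
    using sub Z by (intro emeasure_mono) auto
  finally show False using small by simp
qed

text \<open>At a fixed point there are finitely many gaps, so no point has arbitrarily small
  positive ones. The sets therefore decrease to the empty set, and within the box their measure
  tends to 0. The scale \<open>2 / N\<close> becomes four times the mesh of a grid with
  \<open>2 * N\<close> steps.\<close>

lemma small_gap_set:
  fixes s :: "'m \<Rightarrow> real^2 \<Rightarrow> real"
  assumes M: "finite M" and s: "\<And>m. m \<in> M \<Longrightarrow> s m \<in> borel_measurable borel"
  defines "Z \<equiv> \<lambda>k. {p. \<exists>m\<in>M. \<exists>m'\<in>M. 0 < s m p - s m' p \<and> s m p - s m' p \<le> k}"
  obtains N :: nat where "0 < N" "Z (2 / N) \<in> sets borel"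
    "emeasure lborel (Z (2 / N) \<inter> cbox 0 (vec 2)) < ennreal (1/4)"
proof -
  have Zb: "Z k \<in> sets borel" for k
  proof -
    have "Z k = (\<Union>m\<in>M. \<Union>m'\<in>M. {p. 0 < s m p - s m' p} \<inter> {p. s m p - s m' p \<le> k})"
      by (auto simp: Z_def)
    also have "\<dots> \<in> sets borel"
    proof (intro sets.finite_UN M sets.Int)
      fix m m' assume "m \<in> M" "m' \<in> M"
      then have [measurable]: "s m \<in> borel_measurable borel" "s m' \<in> borel_measurable borel" using s by auto
      show "{p. 0 < s m p - s m' p} \<in> sets borel" "{p. s m p - s m' p \<le> k} \<in> sets borel" by measurable
    qed
    finally show ?thesis .
  qed
  define A where "A N = Z (2 / Suc N) \<inter> cbox 0 (vec 2)" for N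
  have fin: "emeasure lborel (A N) \<noteq> \<infinity>" for N
  proof -
    have "emeasure lborel (A N) \<le> emeasure lborel (cbox 0 (vec 2) :: (real^2) set)"
      by (intro emeasure_mono) (auto simp: A_def)
    then show ?thesis by (metis emeasure_lborel_cbox_finite infinity_ennreal_def leD)
  qed
  have dec: "decseq A"
    unfolding decseq_Suc_iff A_def Z_def
  proof (intro allI Int_mono order_refl subsetI CollectI, clarify)
    fix N p m m' assume *: "m \<in> M" "m' \<in> M" "0 < s m p - s m' p" "s m p - s m' p \<le> 2 / real (Suc (Suc N))"
    have "2 / real (Suc (Suc N)) \<le> 2 / real (Suc N)" by (intro divide_left_mono) auto
    with * show "\<exists>m\<in>M. \<exists>m'\<in>M. 0 < s m p - s m' p \<and> s m p - s m' p \<le> 2 / real (Suc N)"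
      by (meson order_trans)
  qed
  have empty: "(\<Inter>N. A N) = {}"
  proof (rule ccontr)
    assume "(\<Inter>N. A N) \<noteq> {}"
    then obtain p where p: "\<And>N. p \<in> A N" by auto
    define G where "G = {g \<in> (\<lambda>(m, m'). s m p - s m' p) ` (M \<times> M). 0 < g}"
    have G: "finite G" using M by (simp add: G_def)
    have "\<exists>g\<in>G. g \<le> 2 / Suc N" for N
      using p[of N] by (force simp: A_def Z_def G_def)
    moreover from this have "G \<noteq> {}" by auto
    ultimately have "Min G \<le> 2 / Suc N" for N
      using G by (meson Min_le order_trans)
    moreover have "0 < Min G" using Min_in[OF G \<open>G \<noteq> {}\<close>] by (auto simp: G_def)
    then obtain N where "2 / Suc N < Min G"
      using reals_Archimedean[of "Min G / 2"] by (auto simp: field_simps)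
    ultimately show False by (meson leD)
  qed
  have "(\<lambda>N. emeasure lborel (A N)) \<longlonglongrightarrow> emeasure lborel (\<Inter>N. A N)"
    using Zb by (intro Lim_emeasure_decseq fin dec) (auto simp: A_def)
  then have "(\<lambda>N. emeasure lborel (A N)) \<longlonglongrightarrow> 0" by (simp add: empty)
  then have "\<forall>\<^sub>F N in sequentially. emeasure lborel (A N) < ennreal (1/4)"
    by (rule order_tendstoD) simp
  then obtain N where "emeasure lborel (A N) < ennreal (1/4)"
    by (meson eventually_sequentially order_refl)
  with Zb show ?thesis using that[of "Suc N"] by (simp add: A_def)
qed

text \<open>If the middle disk of a null path equals one of the ends, then the drops of \<open>R + x\<close> on the first
  and \<open>R - x\<close> on the second half add up to at least \<open>R2 - R0\<close> minus the absolute change of \<open>x\<close>. Using both axes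
  helps since the two coordinate changes add up to at most \<open>sqrt 2 < 3/2\<close> times \<open>R2 - R0\<close>.\<close>

lemma column_estimate:
  fixes C0 C1 C1' C2 :: "real^2" and R0 R1 R1' R2 :: real
  assumes "dist C0 C2 + R0 \<le> R2"
    and "(C1, R1) = (C0, R0) \<or> (C1, R1) = (C2, R2)"
    and "(C1', R1') = (C0, R0) \<or> (C1', R1') = (C2, R2)"
  shows "R2 - R0 \<le> 2 * (((R2 + C2 $ 1) - (R1 + C1 $ 1)) + ((R1 - C1 $ 1) - (R0 - C0 $ 1))
           + (((R2 + C2 $ 2) - (R1' + C1' $ 2)) + ((R1' - C1' $ 2) - (R0 - C0 $ 2))))"
proof -
  define x y where "x = C0 $ 1 - C2 $ 1" and "y = C0 $ 2 - C2 $ 2"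
  define a where "a = R2 - R0"
  have a: "0 \<le> a" "norm (C0 - C2) \<le> a" using assms(1) zero_le_dist[of C0 C2] unfolding a_def dist_norm by linarith+
  have "norm (C0 - C2) ^ 2 = x\<^sup>2 + y\<^sup>2"
    by (simp add: norm_vec_def L2_set_def sum_2 x_def y_def)
  then have "x\<^sup>2 + y\<^sup>2 \<le> a\<^sup>2" using a by (metis norm_ge_zero power_mono)
  moreover have "(\<bar>x\<bar> + \<bar>y\<bar>)\<^sup>2 \<le> 2 * (x\<^sup>2 + y\<^sup>2)"
    using sum_squares_bound[of "\<bar>x\<bar>" "\<bar>y\<bar>"] by (simp add: power2_sum)
  moreover have "2 * a\<^sup>2 \<le> 9/4 * a\<^sup>2" by simp
  ultimately have "(\<bar>x\<bar> + \<bar>y\<bar>)\<^sup>2 \<le> 9/4 * a\<^sup>2"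
    by (meson mult_left_mono order_trans zero_le_numeral)
  then have "(\<bar>x\<bar> + \<bar>y\<bar>)\<^sup>2 \<le> (3/2 * a)\<^sup>2" by (simp add: power_mult_distrib power_divide)
  then have "\<bar>x\<bar> + \<bar>y\<bar> \<le> 3/2 * a" using a(1) by (meson power2_le_imp_le mult_nonneg_nonneg zero_le_divide_iff zero_le_numeral)
  \<comment> \<open>Depending on which end the middle disk equals, each axis contributes
    \<open>a - x\<close> or \<open>a + x\<close>, and likewise with \<open>y\<close>. The total is
    at least \<open>2 * a - 3/2 * a\<close>, half of \<open>a\<close>, whence the factor 2 in the
    conclusion.\<close>
  then have "x + y \<le> 3/2 * a" "x - y \<le> 3/2 * a" "y - x \<le> 3/2 * a" "- x - y \<le> 3/2 * a"
    by linarith+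
  then show ?thesis using assms(2,3) unfolding x_def y_def a_def by auto
qed

text \<open>The box and the radii in \<open>close\<close> are those the grid needs. The tolerance
  1/40 suffices because more than \<open>n^2 / 2\<close> good columns, each with a radius gain of at
  least 39/40, exceed the bound \<open>16 * (1/40) * n^2\<close> from
  \<open>few_good_columns\<close>.\<close>

lemma no_fine_deflation:
  fixes d :: "(real^2) set \<Rightarrow> (real^2) set"
  assumes disk: "\<And>x. x \<in> carrier Disc \<Longrightarrow> d x \<in> carrier Disc"
    and fin: "finite (d ` carrier Disc)"
    and mono: "\<And>x y. x \<in> carrier Disc \<Longrightarrow> y \<in> carrier Disc \<Longrightarrow> x \<subseteq> y \<Longrightarrow> d x \<subseteq> d y"
    and infl: "\<And>x. x \<in> carrier Disc \<Longrightarrow> x \<subseteq> d x"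
    and opn: "\<And>c r. 0 \<le> r \<Longrightarrow> \<exists>\<delta>>0. d (cball c (r + \<delta>)) \<subseteq> d (cball c r)"
    and close: "\<And>c r. c \<in> cbox 0 (vec 2) \<Longrightarrow> 0 \<le> r \<Longrightarrow> r \<le> 1 \<Longrightarrow> d (cball c r) \<subseteq> cball c (r + 1/40)"
  shows False
proof -
  have car: "cball c r \<in> carrier Disc" if "0 \<le> r" for c r using that by (auto simp: Disc_def)
  have mono': "d (cball c r) \<subseteq> d (cball c' r')" if "0 \<le> r" "dist c c' + r \<le> r'" for c r c' r'
  proof -
    have "0 \<le> r'" using that zero_le_dist[of c c'] by linarith
    then show ?thesis using that by (intro mono car) (auto simp: cball_subset_cball_iff)
  qed
  \<comment> \<open>The value \<open>UNIV\<close> is excluded: its region contains every radius, so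
    \<open>s\<close> would be a supremum of an unbounded set.\<close>
  define M where "M = {m \<in> d ` carrier Disc. \<exists>c r. 0 \<le> r \<and> m = cball c r}"
  have M: "finite M" using fin by (simp add: M_def)
  \<comment> \<open>The region where \<open>d\<close> has a value inside \<open>m\<close> lies below the graph of \<open>s m\<close>; \<open>s m p = 0\<close> if no disk
    around \<open>p\<close> belongs to it.\<close>
  define s where "s m p = Sup (insert 0 {r. 0 \<le> r \<and> d (cball p r) \<subseteq> m})" for m and p :: "real^2"
  have bdd: "bdd_above (insert 0 {r. 0 \<le> r \<and> d (cball p r) \<subseteq> m})" if "m \<in> M" for m p
  proof -
    obtain c r where r: "0 \<le> r" "m = cball c r" using \<open>m \<in> M\<close> by (auto simp: M_def)
    have "q \<le> r" if "0 \<le> q" "d (cball p q) \<subseteq> m" for q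
    proof -
      have "cball p q \<subseteq> cball c r" using infl[OF car[OF that(1)]] that r by auto
      then show ?thesis using that(1) zero_le_dist[of p c] by (auto simp: cball_subset_cball_iff simp del: zero_le_dist)
    qed
    then show ?thesis using r(1) by (intro bdd_aboveI[of _ r]) auto
  qed
  have s0: "0 \<le> s m p" if "m \<in> M" for m p
    unfolding s_def using bdd[OF that] by (intro cSup_upper) auto
  \<comment> \<open>By \<open>opn\<close> the supremum is not attained. Together with
    \<open>s2\<close>, strict inequality describes the region exactly.\<close>
  have s1: "r < s m p" if "m \<in> M" "0 \<le> r" "d (cball p r) \<subseteq> m" for m p r
  proof -
    obtain \<delta> where "0 < \<delta>" "d (cball p (r + \<delta>)) \<subseteq> d (cball p r)" using opn[OF \<open>0 \<le> r\<close>] by blast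
    then have "r + \<delta> \<le> s m p"
      unfolding s_def using that bdd[OF that(1)] by (intro cSup_upper) auto
    then show ?thesis using \<open>0 < \<delta>\<close> by simp
  qed
  have s2: "d (cball p r) \<subseteq> m" if "m \<in> M" "0 \<le> r" "r < s m p" for m p r
  proof -
    obtain q where q: "q \<in> insert 0 {r. 0 \<le> r \<and> d (cball p r) \<subseteq> m}" "r < q"
      using \<open>r < s m p\<close> less_cSup_iff[OF _ bdd[OF \<open>m \<in> M\<close>]] unfolding s_def by blast
    then have "d (cball p r) \<subseteq> d (cball p q)" using that(2) by (intro mono') auto
    then show ?thesis using q that(2) by auto
  qed
  have meas: "s m \<in> borel_measurable borel" if "m \<in> M" for m
    unfolding borel_measurable_iff_greater
  proof
    fix a
    show "{p \<in> space borel. a < s m p} \<in> sets borel"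
    proof (cases "0 \<le> a")
      case True
      have "{p \<in> space borel. a < s m p} = {p. d (cball p a) \<subseteq> m}"
        using s1[OF that True] s2[OF that True] by auto
      \<comment> \<open>Moving the centre by less than \<open>\<delta>\<close> stays inside the disk
        thickened by \<open>\<delta>\<close>, which \<open>opn\<close> allows.\<close>
      moreover have "open {p. d (cball p a) \<subseteq> m}"
        unfolding open_dist
      proof (intro ballI)
        fix p assume "p \<in> {p. d (cball p a) \<subseteq> m}"
        moreover obtain \<delta> where \<delta>: "0 < \<delta>" "d (cball p (a + \<delta>)) \<subseteq> d (cball p a)" using opn[OF True] by blast
        moreover have "d (cball q a) \<subseteq> d (cball p (a + \<delta>))" if "dist q p < \<delta>" for q
          using True that by (intro mono') auto
        ultimately show "\<exists>e>0. \<forall>q. dist q p < e \<longrightarrow> q \<in> {p. d (cball p a) \<subseteq> m}" by blast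
      qed
      ultimately show ?thesis by simp
    next
      case False
      then have "a < s m p" for p using s0[OF that, of p] by linarith
      then have "{p \<in> space borel. a < s m p} = UNIV" by auto
      then show ?thesis by simp
    qed
  qed
  define Z where "Z k = {p. \<exists>m\<in>M. \<exists>m'\<in>M. 0 < s m p - s m' p \<and> s m p - s m' p \<le> k}" for k
  obtain N :: nat where N: "0 < N" "Z (2 / N) \<in> sets borel"
      "emeasure lborel (Z (2 / N) \<inter> cbox 0 (vec 2)) < ennreal (1/4)"
    using small_gap_set[where s = s and M = M, OF M meas] unfolding Z_def by blast
  \<comment> \<open>The number of layers is even to fit double steps, and \<open>2 / N\<close> turns
    into \<open>4 * k\<close>.\<close>
  define n where "n = 2 * N"
  define k where "k = 1 / real n"
  have k: "0 < k" "k * n = 1" "2 / N = 4 * k" "k \<le> 1/2" using N(1) by (auto simp: k_def n_def field_simps)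
  have n0: "0 < n" using N(1) by (simp add: n_def)
  obtain p where p: "p \<in> box 0 (vec k)"
    and few: "card {(i, j) \<in> {..n} \<times> {..n}. p + k *\<^sub>R pt i j \<in> Z (2 / N)} < (real n)\<^sup>2 / 4"
    using grid_average[OF N(2) n0 k_def N(3)] by blast
  define W where "W = {(i, j) \<in> {..n} \<times> {..n}. p + k *\<^sub>R pt i j \<in> Z (2 / N)}"
  have W: "finite W" unfolding W_def by (rule finite_subset[of _ "{..n} \<times> {..n}"]) auto
  define P where "P i j = p + k *\<^sub>R pt i j" for i j
  have P_nth: "P i j $ 1 = p $ 1 + k * i" "P i j $ 2 = p $ 2 + k * j" for i j
    by (simp_all add: P_def)
  have P_in: "P i j \<in> cbox 0 (vec 2)" if "i \<le> n" "j \<le> n" for i j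
  proof -
    have "k * i \<le> k * n" "k * j \<le> k * n" "0 \<le> k * i" "0 \<le> k * j" using that k(1) by auto
    moreover have "0 < p $ 1" "p $ 1 < k" "0 < p $ 2" "p $ 2 < k"
      using p by (auto simp: mem_box_cart forall_2)
    ultimately have "0 \<le> P i j $ 1" "P i j $ 1 \<le> 2" "0 \<le> P i j $ 2" "P i j $ 2 \<le> 2"
      unfolding P_nth using k by linarith+
    then show ?thesis by (auto simp: mem_box_cart forall_2)
  qed
  have P_dist: "dist (P (Suc i) j) (P i j) = k" "dist (P i (Suc j)) (P i j) = k" for i j
  proof -
    have "P (Suc i) j - P i j = k *\<^sub>R vector [1, 0]" "P i (Suc j) - P i j = k *\<^sub>R vector [0, 1]"
      by (auto simp: vec_eq_iff forall_2 P_nth algebra_simps)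
    then show "dist (P (Suc i) j) (P i j) = k" "dist (P i (Suc j)) (P i j) = k"
      using k by (auto simp: dist_norm norm_vec_def L2_set_def sum_2)
  qed
  define v where "v i j l = d (cball (P i j) (k * real l))" for i j l
  have near: "\<exists>c r. v i j l = cball c r \<and> dist (P i j) c + k * l \<le> r \<and> dist c (P i j) + r \<le> k * l + 1/40 \<and> 0 \<le> r"
    if "i \<le> n" "j \<le> n" "l \<le> n" for i j l
  proof -
    have kl: "0 \<le> k * l" "k * l \<le> 1" using k(1,2) that mult_left_mono[of "real l" "real n" k] by auto
    have sub: "v i j l \<subseteq> cball (P i j) (k * l + 1/40)" "cball (P i j) (k * l) \<subseteq> v i j l"
      using close[OF P_in kl] infl[OF car[OF kl(1)]] that by (auto simp: v_def)
    have "v i j l \<noteq> UNIV" using sub(1) bounded_cball bounded_subset not_bounded_UNIV by metis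
    then obtain c r where "0 \<le> r" "v i j l = cball c r"
      using disk[OF car[OF kl(1), of "P i j"]] by (auto simp: v_def Disc_def)
    then show ?thesis using sub kl by (auto simp: cball_subset_cball_iff)
  qed
  then obtain C R where CR: "\<And>i j l. i \<le> n \<Longrightarrow> j \<le> n \<Longrightarrow> l \<le> n \<Longrightarrow>
      v i j l = cball (C i j l) (R i j l) \<and> dist (P i j) (C i j l) + k * l \<le> R i j l
      \<and> dist (C i j l) (P i j) + R i j l \<le> k * l + 1/40 \<and> 0 \<le> R i j l"
    by metis
  have comp: "\<bar>C i j l $ q - P i j $ q\<bar> \<le> dist (C i j l) (P i j)" for i j l q
    using component_le_norm_cart[of "C i j l - P i j" q] by (simp add: dist_norm)
  \<comment> \<open>Measured from \<open>p\<close>, so that the identity has coordinates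
    \<open>k * i\<close> and \<open>k * j\<close>.\<close>
  define X where "X i j l = C i j l $ 1 - p $ 1" for i j l
  define Y where "Y i j l = C i j l $ 2 - p $ 2" for i j l
  have v_sub: "dist (C i j l) (C i' j' l') + R i j l \<le> R i' j' l'"
    if "i \<le> n" "j \<le> n" "l \<le> n" "i' \<le> n" "j' \<le> n" "l' \<le> n" "dist (P i j) (P i' j') + k * l \<le> k * l'" for i j l i' j' l'
  proof -
    have "v i j l \<subseteq> v i' j' l'" unfolding v_def using k that by (intro mono') auto
    then show ?thesis using CR[of i j l] CR[of i' j' l'] that by (auto simp: cball_subset_cball_iff)
  qed
  have c_le: "\<bar>C i j l $ q - C i' j' l' $ q\<bar> \<le> dist (C i j l) (C i' j' l')" for i j l i' j' l' q
    using component_le_norm_cart[of "C i j l - C i' j' l'" q] by (simp add: dist_norm)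
  have mid: "d (cball q \<rho>) = d (cball p' (\<rho> + k)) \<or> d (cball q \<rho>) = d (cball p' (\<rho> - k))"
    if q: "dist q p' = k" "q \<notin> Z (4 * k)" "k \<le> \<rho>"
      and b: "d (cball q \<rho>) \<subseteq> cball q' \<rho>'" for q p' \<rho> q' \<rho>'
  proof (rule ccontr)
    assume neq: "\<not> ?thesis"
    have inM: "d (cball a t) \<in> M" if "0 \<le> t" "d (cball a t) \<subseteq> cball q' \<rho>'" for a t
    proof -
      have "d (cball a t) \<noteq> UNIV" using that bounded_cball bounded_subset not_bounded_UNIV by metis
      then have "\<exists>c r. 0 \<le> r \<and> d (cball a t) = cball c r"
        using disk[OF car[OF that(1), of a]] by (auto simp: Disc_def)
      then show ?thesis using car[OF that(1), of a] unfolding M_def by blast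
    qed
    have chain: "d (cball p' (\<rho> - k)) \<subseteq> d (cball q \<rho>)" "d (cball q \<rho>) \<subseteq> d (cball p' (\<rho> + k))"
      using mono'[of "\<rho> - k" p' q \<rho>] mono'[of \<rho> q p' "\<rho> + k"] q(1,3) k(1) by (auto simp: dist_commute)
    define m m0 where "m = d (cball q \<rho>)" and "m0 = d (cball p' (\<rho> - k))"
    have mM: "m \<in> M" "m0 \<in> M" using inM chain b q k by (auto simp: m_def m0_def)
    \<comment> \<open>If the three values differ, the graph of \<open>m\<close> over
      \<open>q\<close> has height in the interval from \<open>\<rho>\<close> to
      \<open>\<rho> + 2 * k\<close>, that of \<open>m0\<close> in the one from
      \<open>\<rho> - 2 * k\<close> to \<open>\<rho>\<close>. They are distinct and at most
      \<open>4 * k\<close> apart.\<close>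
    have "\<rho> < s m q" using s1[OF mM(1)] q k by (auto simp: m_def)
    moreover have "s m0 q \<le> \<rho>"
    proof (rule ccontr)
      assume "\<not> s m0 q \<le> \<rho>"
      then have "m \<subseteq> m0" using s2[OF mM(2), of \<rho> q] q k by (auto simp: m_def)
      then show False using neq chain by (auto simp: m_def m0_def)
    qed
    moreover have "s m q \<le> \<rho> + 2 * k"
    proof (rule ccontr)
      assume "\<not> ?thesis"
      then have "d (cball q (\<rho> + 2 * k)) \<subseteq> m" using s2[OF mM(1), of "\<rho> + 2 * k" q] q k by auto
      moreover have "d (cball p' (\<rho> + k)) \<subseteq> d (cball q (\<rho> + 2 * k))"
        using q k by (intro mono') (auto simp: dist_commute)
      ultimately show False using neq chain by (auto simp: m_def m0_def)
    qed
    moreover have "\<rho> - 2 * k \<le> s m0 q"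
    proof (cases "0 \<le> \<rho> - 2 * k")
      case True
      then have "d (cball q (\<rho> - 2 * k)) \<subseteq> m0" unfolding m0_def using q by (intro mono') auto
      then show ?thesis using s1[OF mM(2) True] by (meson less_imp_le)
    qed (use s0[OF mM(2), of q] in linarith)
    ultimately have "q \<in> Z (4 * k)" unfolding Z_def using mM
      by (intro CollectI bexI[of _ m] bexI[of _ m0]) auto
    then show False using q by simp
  qed
  \<comment> \<open>By \<open>mid\<close>, a third value between the ends of a double step forces two distinct graphs over the
    neighbouring column to be \<open>4 * k\<close>-close.\<close>
  define good where "good = {(i, j) \<in> {..<n} \<times> {..<n}. (Suc i, j) \<notin> W \<and> (i, Suc j) \<notin> W}"
  have card_good: "(real n)\<^sup>2 / 2 < card good"
  proof -
    \<comment> \<open>Each column that is not good is the left or lower neighbour of a point of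
      \<open>W\<close>, so fewer than \<open>n^2 / 2\<close> are lost.\<close>
    have "{..<n} \<times> {..<n} \<subseteq> good \<union> ((\<lambda>(i, j). (i - 1, j)) ` W \<union> (\<lambda>(i, j). (i, j - 1)) ` W)"
      by (force simp: good_def)
    moreover have "finite good" unfolding good_def by (rule finite_subset[of _ "{..<n} \<times> {..<n}"]) auto
    ultimately have "card ({..<n} \<times> {..<n}) \<le> card good + (card W + card W)"
      using W by (meson card_Un_le card_image_le card_mono finite_UnI finite_imageI add_mono order_refl order_trans)
    then have "real (n * n) \<le> real (card good + (card W + card W))"
      by (simp only: of_nat_le_iff card_cartesian_product card_lessThan)
    then show ?thesis using few by (simp add: W_def power2_eq_square)
  qed
  have "real (card good) * (k * n - 1/40) \<le> 16 * (1/40) * (real n)\<^sup>2"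
  proof (rule few_good_columns[where R = R and X = X and Y = Y and N = N])
    show "n = 2 * N" by (simp add: n_def)
  next
    show "good \<subseteq> {..<n} \<times> {..<n}" by (auto simp: good_def)
  next
    fix i j l assume *: "i \<le> n" "j \<le> n" "l \<le> n"
    note facts = CR[OF *] comp[of i j l 1, unfolded P_nth] comp[of i j l 2, unfolded P_nth]
    show "k * (real l + real i) \<le> R i j l + X i j l \<and> R i j l + X i j l \<le> k * (real l + real i) + 1/40"
      "k * (real l - real i) \<le> R i j l - X i j l \<and> R i j l - X i j l \<le> k * (real l - real i) + 1/40"
      "k * (real l + real j) \<le> R i j l + Y i j l \<and> R i j l + Y i j l \<le> k * (real l + real j) + 1/40"
      "k * (real l - real j) \<le> R i j l - Y i j l \<and> R i j l - Y i j l \<le> k * (real l - real j) + 1/40"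
      using facts by (auto simp: X_def Y_def algebra_simps dist_commute abs_le_iff)
  next
    fix i j l assume *: "i < n" "j < n" "l < n"
    show "R (Suc i) j l + X (Suc i) j l \<le> R i j (Suc l) + X i j (Suc l)"
      using v_sub[of "Suc i" j l i j "Suc l"] c_le[of "Suc i" j l 1 i j "Suc l"] * P_dist[of i j]
      by (auto simp: X_def algebra_simps)
    show "R i (Suc j) l + Y i (Suc j) l \<le> R i j (Suc l) + Y i j (Suc l)"
      using v_sub[of i "Suc j" l i j "Suc l"] c_le[of i "Suc j" l 2 i j "Suc l"] * P_dist[of i j]
      by (auto simp: Y_def algebra_simps)
    show "R i j l - X i j l \<le> R (Suc i) j (Suc l) - X (Suc i) j (Suc l)"
      using v_sub[of i j l "Suc i" j "Suc l"] c_le[of i j l 1 "Suc i" j "Suc l"] * P_dist[of i j]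
      by (auto simp: X_def algebra_simps dist_commute)
    show "R i j l - Y i j l \<le> R i (Suc j) (Suc l) - Y i (Suc j) (Suc l)"
      using v_sub[of i j l i "Suc j" "Suc l"] c_le[of i j l 2 i "Suc j" "Suc l"] * P_dist[of i j]
      by (auto simp: Y_def algebra_simps dist_commute)
  next
    fix i j l assume *: "(i, j) \<in> good" "l < N"
    then have lt: "i < n" "j < n" "Suc (2 * l) < n" by (auto simp: good_def n_def)
    have notZ: "P (Suc i) j \<notin> Z (4 * k)" "P i (Suc j) \<notin> Z (4 * k)"
      using * lt k by (auto simp: good_def W_def P_def)
    have arith: "k * (1 + 2 * real l) + k = k * real (2 * l + 2)" "k * (1 + 2 * real l) - k = k * real (2 * l)"
      by (simp_all add: algebra_simps)
    \<comment> \<open>The lower end of the double step must have nonnegative radius; for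
      \<open>l = 0\<close> it is a point.\<close>
    have kk: "k \<le> k * (1 + 2 * real l)" using k by simp
    have "v (Suc i) j (2*l+1) = v i j (2*l+2) \<or> v (Suc i) j (2*l+1) = v i j (2*l)"
      using mid[OF P_dist(1) notZ(1) kk] CR[of "Suc i" j "2*l+1"] lt arith by (auto simp: v_def)
    then have 1: "(C (Suc i) j (2*l+1), R (Suc i) j (2*l+1)) = (C i j (2*l), R i j (2*l)) \<or>
        (C (Suc i) j (2*l+1), R (Suc i) j (2*l+1)) = (C i j (2*l+2), R i j (2*l+2))"
      using CR[of "Suc i" j "2*l+1"] CR[of i j "2*l+2"] CR[of i j "2*l"] lt by (auto simp: cball_eq_cball_iff)
    have "v i (Suc j) (2*l+1) = v i j (2*l+2) \<or> v i (Suc j) (2*l+1) = v i j (2*l)"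
      using mid[OF P_dist(2) notZ(2) kk] CR[of i "Suc j" "2*l+1"] lt arith by (auto simp: v_def)
    then have 2: "(C i (Suc j) (2*l+1), R i (Suc j) (2*l+1)) = (C i j (2*l), R i j (2*l)) \<or>
        (C i (Suc j) (2*l+1), R i (Suc j) (2*l+1)) = (C i j (2*l+2), R i j (2*l+2))"
      using CR[of i "Suc j" "2*l+1"] CR[of i j "2*l+2"] CR[of i j "2*l"] lt by (auto simp: cball_eq_cball_iff)
    have 3: "dist (C i j (2*l)) (C i j (2*l+2)) + R i j (2*l) \<le> R i j (2*l+2)"
      using v_sub[of i j "2*l" i j "2*l+2"] lt k by auto
    show "R i j (2 * l + 2) - R i j (2 * l) \<le> 2 * (
          ((R i j (2 * l + 2) + X i j (2 * l + 2)) - (R (Suc i) j (2 * l + 1) + X (Suc i) j (2 * l + 1)))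
        + ((R (Suc i) j (2 * l + 1) - X (Suc i) j (2 * l + 1)) - (R i j (2 * l) - X i j (2 * l)))
        + (((R i j (2 * l + 2) + Y i j (2 * l + 2)) - (R i (Suc j) (2 * l + 1) + Y i (Suc j) (2 * l + 1)))
        + ((R i (Suc j) (2 * l + 1) - Y i (Suc j) (2 * l + 1)) - (R i j (2 * l) - Y i j (2 * l)))))"
      using column_estimate[OF 3 1 2] unfolding X_def Y_def by (simp add: algebra_simps)
  qed
  moreover have "n\<^sup>2 / 2 * (39/40) < card good * (39/40 :: real)" using card_good by simp
  moreover have "0 < (real n)\<^sup>2" using n0 by simp
  ultimately show False using k by simp
qed

subsection \<open>The function space is not continuous\<close>

text \<open>Only the integer part of the first coordinate of a code matters, so every rational disk has
  uncountably many codes. A negative radius \<open>q\<close> is replaced by its absolute value.\<close>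

definition code_disk :: "real^2 \<Rightarrow> (real^2) set" where
  "code_disk v = (case from_nat (nat \<lfloor>v $ 1\<rfloor>) of (a, b, q) \<Rightarrow>
     cball (vector [of_rat a, of_rat b]) \<bar>of_rat q\<bar>)"

lemma code_disk_cball: "\<exists>c r. 0 \<le> r \<and> code_disk v = cball c r"
proof -
  obtain a b q where "from_nat (nat \<lfloor>v $ 1\<rfloor>) = (a :: rat, b :: rat, q :: rat)" by (rule prod_cases3)
  then show ?thesis
    by (intro exI[of _ "vector [of_rat a, of_rat b]"] exI[of _ "\<bar>of_rat q\<bar>"]) (simp add: code_disk_def)
qed

lemma interior_code_disk_neq_UNIV: "interior (code_disk v) \<noteq> UNIV"
proof
  assume *: "interior (code_disk v) = UNIV"
  obtain c r where "code_disk v = cball c r" using code_disk_cball by blast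
  then have "bounded (interior (code_disk v))" by (simp add: bounded_interior)
  then show False unfolding * using not_bounded_UNIV by blast
qed

text \<open>The rational disk is encoded in the first coordinate. The second coordinate is free, so
  uncountably many codes denote the same disk and some code avoids \<open>Q\<close>.\<close>

lemma fresh_code:
  assumes "countable Q" "0 \<le> r" "0 < \<delta>"
  shows "\<exists>v. v \<notin> Q \<and> cball c r \<subseteq> interior (code_disk v) \<and> code_disk v \<subseteq> cball c (r + \<delta>)"
proof -
  \<comment> \<open>The centre moves by less than \<open>e\<close> and the radius grows by more than
    \<open>e\<close> but less than \<open>3 * e\<close>. This leaves \<open>cball c r\<close> in the
    interior and stays within \<open>4 * e\<close>.\<close>
  define e where "e = \<delta> / 4"
  have e: "0 < e" "\<delta> = 4 * e" using assms(3) by (simp_all add: e_def)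
  obtain a :: rat where a: "c $ 1 - e / 2 < of_rat a" "of_rat a < c $ 1 + e / 2"
    using of_rat_dense[of "c $ 1 - e / 2" "c $ 1 + e / 2"] e by force
  obtain b :: rat where b: "c $ 2 - e / 2 < of_rat b" "of_rat b < c $ 2 + e / 2"
    using of_rat_dense[of "c $ 2 - e / 2" "c $ 2 + e / 2"] e by force
  obtain q :: rat where q: "r + e < of_rat q" "of_rat q < r + 3 * e"
    using of_rat_dense[of "r + e" "r + 3 * e"] e by force
  define c' :: "real^2" where "c' = vector [of_rat a, of_rat b]"
  have "norm (c - c') \<le> \<bar>(c - c') $ 1\<bar> + \<bar>(c - c') $ 2\<bar>"
    using norm_le_l1_cart[of "c - c'"] by (simp add: sum_2)
  then have dist: "dist c c' < e" using a b by (simp add: dist_norm c'_def)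
  define k where "k = to_nat (a, b, q)"
  define code :: "real \<Rightarrow> real^2" where "code y = vector [real k, y]" for y
  have "inj code"
  proof (rule injI)
    fix y z assume "code y = code z"
    then have "code y $ 2 = code z $ 2" by simp
    then show "y = z" by (simp add: code_def)
  qed
  have "\<not> range code \<subseteq> Q"
  proof
    assume "range code \<subseteq> Q"
    then have "countable (range code)" using assms(1) by (rule countable_subset)
    then have "countable (UNIV :: real set)" using \<open>inj code\<close> by (rule countable_image_inj_on)
    then show False using uncountable_UNIV_real by simp
  qed
  then obtain y where y: "code y \<notin> Q" by blast
  have "0 < (of_rat q :: real)" using q(1) assms(2) e(1) by linarith
  then have q0: "\<bar>q\<bar> = q" by simp
  have cd: "code_disk (code y) = cball c' (of_rat q)"
    by (simp add: code_disk_def code_def k_def c'_def q0)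
  have "cball c r \<subseteq> interior (code_disk (code y))"
    unfolding cd interior_cball cball_subset_ball_iff using dist q by simp
  moreover have "code_disk (code y) \<subseteq> cball c (r + \<delta>)"
    unfolding cd cball_subset_cball_iff using dist q e by (simp add: dist_commute)
  ultimately show ?thesis using y by blast
qed

text \<open>The empty set supplies the bottom ideal and the only value possible at
  \<open>UNIV\<close>, which lies in the interior of no disk.\<close>

definition code_sets :: "(real^2) set set" where
  "code_sets = {A. finite A \<and> (A = {} \<or> (\<exists>a\<in>A. \<forall>b\<in>A. code_disk a \<subseteq> code_disk b))}"

text \<open>\<open>Q\<close> holds the deleted codes: \<open>Q = {}\<close> gives the limit map, the
  tails of a sequence give the maps that converge to it.\<close>

definition cover :: "(real^2) set \<Rightarrow> (real^2) set \<Rightarrow> (real^2) set set" where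
  "cover Q x = {A \<in> code_sets. A \<inter> Q = {} \<and> (\<forall>a\<in>A. x \<subseteq> interior (code_disk a))}"

lemma empty_in_code_sets: "{} \<in> code_sets"
  by (simp add: code_sets_def)

lemma finite_code_sets: "A \<in> code_sets \<Longrightarrow> finite A"
  by (simp add: code_sets_def)

lemma open_interior_codes: "finite A \<Longrightarrow> open (\<Inter>a\<in>A. interior (code_disk a))"
  by (rule open_INT) auto

text \<open>Directedness is the point, since a union of two members may lack a least disk. A fresh
  code for a disk squeezed between \<open>x\<close> and the open intersection of the interiors
  supplies one.\<close>

lemma cover_ideal:
  assumes Q: "countable Q" and x: "x \<in> carrier Disc"
  shows "cover Q x \<in> ideals code_sets"
proof (rule idealsI)
  show "cover Q x \<subseteq> code_sets" by (simp add: cover_def)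
  have empty: "{} \<in> cover Q x" by (simp add: cover_def empty_in_code_sets)
  then show "cover Q x \<noteq> {}" by blast
  show "B \<in> cover Q x" if "A \<in> cover Q x" "B \<in> code_sets" "B \<subseteq> A" for A B
    using that unfolding cover_def by blast
  show "\<exists>C\<in>cover Q x. A \<subseteq> C \<and> B \<subseteq> C" if AB: "A \<in> cover Q x" "B \<in> cover Q x" for A B
  proof (cases "x = UNIV")
    case True
    have "A = {}" "B = {}"
      using AB interior_code_disk_neq_UNIV unfolding cover_def True by blast+
    then show ?thesis using empty by blast
  next
    case False
    with x obtain c r where x_eq: "x = cball c r" "0 \<le> r" by (rule Disc_cases)
    define U where "U = (\<Inter>a\<in>A \<union> B. interior (code_disk a))"
    have fin: "finite (A \<union> B)" using AB finite_code_sets unfolding cover_def by blast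
    have "open U" unfolding U_def by (rule open_interior_codes[OF fin])
    moreover have sub: "cball c r \<subseteq> U" using AB unfolding U_def cover_def x_eq by blast
    ultimately obtain \<delta> where \<delta>: "0 < \<delta>" "cball c (r + \<delta>) \<subseteq> U"
      using Disc_subset_open[OF x_eq(2)] by metis
    obtain v where v: "v \<notin> Q" "cball c r \<subseteq> interior (code_disk v)" "code_disk v \<subseteq> cball c (r + \<delta>)"
      using fresh_code[OF Q x_eq(2) \<delta>(1)] by blast
    have "code_disk v \<subseteq> code_disk a" if "a \<in> A \<union> B" for a
    proof -
      have "U \<subseteq> interior (code_disk a)" using that unfolding U_def by blast
      then show ?thesis using v(3) \<delta>(2) interior_subset[of "code_disk a"] by blast
    qed
    then have "insert v (A \<union> B) \<in> code_sets" using fin by (auto simp: code_sets_def)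
    moreover have "insert v (A \<union> B) \<inter> Q = {}" using v(1) AB unfolding cover_def by blast
    moreover have "\<forall>a\<in>insert v (A \<union> B). x \<subseteq> interior (code_disk a)"
      using v(2) AB unfolding cover_def x_eq by blast
    ultimately have "insert v (A \<union> B) \<in> cover Q x" unfolding cover_def by (intro CollectI conjI)
    then show ?thesis by (rule bexI[rotated]) blast
  qed
qed

lemma cover_antimono: "y \<subseteq> x \<Longrightarrow> cover Q x \<subseteq> cover Q y"
  unfolding cover_def by blast

text \<open>A finite \<open>A\<close> imposes an open condition on \<open>x\<close>, and a directed
  family whose intersection satisfies it has a member satisfying it.\<close>

lemma scott_continuous_cover:
  assumes "countable Q"
  shows "scott_continuous Disc (Idl code_sets) (cover Q)"
proof (rule scott_continuousI[OF partial_order_Disc partial_order_Idl])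
  show "cover Q x \<in> carrier (Idl code_sets)" if "x \<in> carrier Disc" for x
    using cover_ideal[OF assms that] by simp
  show "cover Q x \<sqsubseteq>\<^bsub>Idl code_sets\<^esub> cover Q y" if "x \<sqsubseteq>\<^bsub>Disc\<^esub> y" for x y
    using that cover_antimono by simp
  fix D s u assume D: "directed_in Disc D" "is_sup Disc s D"
    and u: "\<And>x. x \<in> D \<Longrightarrow> cover Q x \<sqsubseteq>\<^bsub>Idl code_sets\<^esub> u"
  have s: "s = \<Inter>D" using D(2) is_sup_Disc[OF D(1)] by simp
  have "A \<in> u" if A: "A \<in> cover Q s" for A
  proof -
    have A': "A \<in> code_sets" "A \<inter> Q = {}" "\<forall>a\<in>A. s \<subseteq> interior (code_disk a)"
      using A by (simp_all add: cover_def)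
    then have "\<Inter>D \<subseteq> (\<Inter>a\<in>A. interior (code_disk a))" unfolding s by blast
    then obtain x where x: "x \<in> D" "x \<subseteq> (\<Inter>a\<in>A. interior (code_disk a))"
      using directed_Disc_subset_open[OF D(1)] open_interior_codes[OF finite_code_sets[OF A'(1)]] by blast
    then have "\<forall>a\<in>A. x \<subseteq> interior (code_disk a)" by blast
    then have "A \<in> cover Q x" using A' by (simp add: cover_def)
    then show ?thesis using u[OF x(1)] by auto
  qed
  then show "cover Q s \<sqsubseteq>\<^bsub>Idl code_sets\<^esub> u" unfolding le_Idl by (rule subsetI)
qed

abbreviation Cover :: "(real^2) set \<Rightarrow> (real^2) set \<Rightarrow> (real^2) set set" where
  "Cover Q \<equiv> restrict (cover Q) (carrier Disc)"

abbreviation Maps :: "((real^2) set \<Rightarrow> (real^2) set set) gorder" where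
  "Maps \<equiv> fun_space Disc (Idl code_sets)"

lemma Cover_in_Maps: "countable Q \<Longrightarrow> Cover Q \<in> carrier Maps"
  by (rule scott_continuous_restrict[OF partial_order_Disc scott_continuous_cover])

text \<open>Omitting the countably many codes \<open>f i, f (i + 1), \<dots>\<close> leaves enough codes for each disk.\<close>

lemma directed_Cover_tails:
  fixes f :: "nat \<Rightarrow> real^2"
  assumes f: "inj f"
  defines "F \<equiv> range (\<lambda>i. Cover (f ` {i..}))"
  shows "directed_in Maps F" "is_sup Maps (Cover {}) F"
proof -
  have countable: "countable (f ` {i..})" for i by simp
  have F: "F \<subseteq> carrier Maps"
    using Cover_in_Maps[OF countable] unfolding F_def by blast
  have mono: "Cover Q \<sqsubseteq>\<^bsub>Maps\<^esub> Cover Q'" if "Q' \<subseteq> Q" for Q Q'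
  proof -
    have "cover Q x \<subseteq> cover Q' x" for x using that unfolding cover_def by blast
    then show ?thesis by (simp add: le_fun_space)
  qed
  have "\<exists>k\<in>F. g \<sqsubseteq>\<^bsub>Maps\<^esub> k \<and> h \<sqsubseteq>\<^bsub>Maps\<^esub> k" if gh: "g \<in> F" "h \<in> F" for g h
  proof -
    obtain i j where ij: "g = Cover (f ` {i..})" "h = Cover (f ` {j..})" using gh unfolding F_def by blast
    have "f ` {max i j..} \<subseteq> f ` {i..}" "f ` {max i j..} \<subseteq> f ` {j..}" by (simp_all add: image_mono)
    then have "g \<sqsubseteq>\<^bsub>Maps\<^esub> Cover (f ` {max i j..})" "h \<sqsubseteq>\<^bsub>Maps\<^esub> Cover (f ` {max i j..})"
      unfolding ij by (simp_all only: mono)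
    moreover have "Cover (f ` {max i j..}) \<in> F" unfolding F_def by blast
    ultimately show ?thesis by blast
  qed
  moreover have "F \<noteq> {}" unfolding F_def by blast
  ultimately show "directed_in Maps F" using F unfolding directed_in_def by blast
  show "is_sup Maps (Cover {}) F"
    unfolding is_sup_iff[OF F]
  proof (intro conjI ballI impI)
    show "Cover {} \<in> carrier Maps" by (rule Cover_in_Maps) simp
    show "g \<sqsubseteq>\<^bsub>Maps\<^esub> Cover {}" if "g \<in> F" for g
    proof -
      obtain i where "g = Cover (f ` {i..})" using \<open>g \<in> F\<close> unfolding F_def by blast
      then show ?thesis using mono[OF empty_subsetI] by simp
    qed
    show "Cover {} \<sqsubseteq>\<^bsub>Maps\<^esub> u" if u: "\<forall>g\<in>F. g \<sqsubseteq>\<^bsub>Maps\<^esub> u" for u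
      unfolding le_fun_space le_Idl
    proof (intro ballI subsetI)
      fix x A assume x: "x \<in> carrier Disc" and A: "A \<in> Cover {} x"
      then have A': "A \<in> cover {} x" by simp
      \<comment> \<open>A finite set contains only finitely many terms of an injective sequence, so
        it misses a late tail.\<close>
      then have "finite A" using finite_code_sets unfolding cover_def by blast
      then have "finite (f -` A)" using f by (rule finite_vimageI)
      then obtain i where i: "\<forall>k\<in>f -` A. k < i" using finite_nat_set_iff_bounded by blast
      have "A \<inter> f ` {i..} = {}"
      proof (rule ccontr)
        assume "A \<inter> f ` {i..} \<noteq> {}"
        then obtain k where "i \<le> k" "f k \<in> A" by blast
        then have "k \<in> f -` A" by simp
        then have "k < i" using i by (rule bspec[rotated])
        then show False using \<open>i \<le> k\<close> by simp
      qed
      then have "A \<in> Cover (f ` {i..}) x" using A' x by (simp add: cover_def)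
      moreover have "Cover (f ` {i..}) \<sqsubseteq>\<^bsub>Maps\<^esub> u" using u unfolding F_def by blast
      then have "Cover (f ` {i..}) x \<subseteq> u x" using x unfolding le_fun_space le_Idl by blast
      ultimately show "A \<in> u x" by blast
    qed
  qed
qed

section \<open>Maps way below the cover map\<close>

lemma finite_codes_way_below:
  assumes g: "way_below Maps g (Cover {})"
  shows "finite (\<Union>x\<in>carrier Disc. \<Union>(g x))"
proof (rule ccontr)
  assume "infinite (\<Union>x\<in>carrier Disc. \<Union>(g x))"
  then obtain f :: "nat \<Rightarrow> real^2" where f: "inj f" "range f \<subseteq> (\<Union>x\<in>carrier Disc. \<Union>(g x))"
    using infinite_countable_subset by blast
  have "Cover {} \<sqsubseteq>\<^bsub>Maps\<^esub> Cover {}" by (simp add: le_fun_space)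
  then have "\<exists>h\<in>range (\<lambda>i. Cover (f ` {i..})). g \<sqsubseteq>\<^bsub>Maps\<^esub> h"
    using g directed_Cover_tails[OF f(1)] unfolding way_below_def by blast
  then obtain i where i: "g \<sqsubseteq>\<^bsub>Maps\<^esub> Cover (f ` {i..})" by blast
  \<comment> \<open>The term \<open>f i\<close> is in use by \<open>g\<close> but is among the codes
    deleted in the tail starting at \<open>i\<close>.\<close>
  obtain x A where x: "x \<in> carrier Disc" "A \<in> g x" "f i \<in> A" using f(2) by blast
  then have "A \<in> cover (f ` {i..}) x" using i unfolding le_fun_space le_Idl by auto
  then show False using x(3) unfolding cover_def by blast
qed

text \<open>If \<open>g x\<close> uses no code, the empty intersection gives \<open>UNIV\<close>,
  the least element of \<open>Disc\<close>.\<close>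

definition deflate :: "((real^2) set \<Rightarrow> (real^2) set set) \<Rightarrow> (real^2) set \<Rightarrow> (real^2) set" where
  "deflate g x = (\<Inter>a\<in>\<Union>(g x). code_disk a)"

lemma deflate_antimono:
  assumes "\<Union>(g y) \<subseteq> \<Union>(g x)"
  shows "deflate g x \<subseteq> deflate g y"
  unfolding deflate_def by (rule INT_anti_mono[OF assms subset_refl])

text \<open>Supplies every hypothesis of \<open>no_fine_deflation\<close> except closeness. With
  finitely many codes in total, all codes used at \<open>x\<close> form one element of
  \<open>g x\<close>; its least disk is the value of \<open>deflate g\<close>.\<close>

lemma deflation_from_way_below:
  assumes g: "way_below Maps g (Cover {})"
  shows "\<And>x. x \<in> carrier Disc \<Longrightarrow> deflate g x \<in> carrier Disc"
    and "finite (deflate g ` carrier Disc)"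
    and "\<And>x y. x \<in> carrier Disc \<Longrightarrow> y \<in> carrier Disc \<Longrightarrow> x \<subseteq> y \<Longrightarrow> deflate g x \<subseteq> deflate g y"
    and "\<And>x. x \<in> carrier Disc \<Longrightarrow> x \<subseteq> deflate g x"
    and "\<And>c r. 0 \<le> r \<Longrightarrow> \<exists>\<delta>>0. deflate g (cball c (r + \<delta>)) \<subseteq> deflate g (cball c r)"
proof -
  define N where "N = (\<Union>x\<in>carrier Disc. \<Union>(g x))"
  have N: "finite N" unfolding N_def by (rule finite_codes_way_below[OF g])
  have gN: "\<Union>(g x) \<subseteq> N" if "x \<in> carrier Disc" for x using that unfolding N_def by blast
  have sc: "scott_continuous Disc (Idl code_sets) g"
    using g by (simp add: way_below_def carrier_fun_space)
  have ideal: "g x \<in> ideals code_sets" if "x \<in> carrier Disc" for x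
    using scott_continuousD(1)[OF sc that] by simp
  have mem: "\<Union>(g x) \<in> g x" if "x \<in> carrier Disc" for x
    using gN[OF that] N by (intro ideal_Union_mem[OF ideal[OF that]]) (rule finite_subset)
  have "g \<sqsubseteq>\<^bsub>Maps\<^esub> Cover {}"
  proof -
    have car: "Cover {} \<in> carrier Maps" by (rule Cover_in_Maps) simp
    \<comment> \<open>Way-below is tested on a singleton family to obtain the order
      relation.\<close>
    have D: "directed_in Maps {Cover {}}" using car by (simp add: directed_in_def le_fun_space)
    have "is_sup Maps (Cover {}) {Cover {}}" using car by (simp add: is_sup_iff le_fun_space)
    moreover have "Cover {} \<sqsubseteq>\<^bsub>Maps\<^esub> Cover {}" by (simp add: le_fun_space)
    ultimately have "\<exists>d\<in>{Cover {}}. g \<sqsubseteq>\<^bsub>Maps\<^esub> d" using g D unfolding way_below_def by blast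
    then show ?thesis by simp
  qed
  then have le: "g x \<subseteq> cover {} x" if "x \<in> carrier Disc" for x
    using that by (simp add: le_fun_space)
  show mono: "deflate g x \<subseteq> deflate g y" if xy: "x \<in> carrier Disc" "y \<in> carrier Disc" "x \<subseteq> y" for x y
  proof -
    have "g y \<subseteq> g x" using scott_continuousD(2)[OF sc xy(2) xy(1)] xy(3) by simp
    then show ?thesis by (intro deflate_antimono Union_mono)
  qed
  show "deflate g x \<in> carrier Disc" if x: "x \<in> carrier Disc" for x
  proof -
    have "\<Union>(g x) \<in> code_sets" using mem[OF x] idealsD(1)[OF ideal[OF x]] by blast
    then consider "\<Union>(g x) = {}" | a where "a \<in> \<Union>(g x)" "\<forall>b\<in>\<Union>(g x). code_disk a \<subseteq> code_disk b"
      unfolding code_sets_def by blast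
    then show ?thesis
    proof cases
      case 1
      then show ?thesis unfolding deflate_def 1 by simp
    next
      case 2
      have "deflate g x = code_disk a"
        unfolding deflate_def using INT_lower[OF 2(1)] INT_greatest[OF bspec[OF 2(2)]] by (rule subset_antisym)
      then show ?thesis using code_disk_cball[of a] by (auto simp: carrier_Disc)
    qed
  qed
  have "deflate g ` carrier Disc \<subseteq> (\<lambda>A. \<Inter>a\<in>A. code_disk a) ` Pow N"
  proof (rule image_subsetI)
    fix x assume "x \<in> carrier Disc"
    then show "deflate g x \<in> (\<lambda>A. \<Inter>a\<in>A. code_disk a) ` Pow N"
      unfolding deflate_def using gN by (intro imageI PowI)
  qed
  then show "finite (deflate g ` carrier Disc)" by (rule finite_subset) (simp add: N)
  show "x \<subseteq> deflate g x" if x: "x \<in> carrier Disc" for x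
  proof -
    have "\<Union>(g x) \<in> cover {} x" using mem[OF x] le[OF x] by blast
    then have *: "\<forall>a\<in>\<Union>(g x). x \<subseteq> interior (code_disk a)" unfolding cover_def by (elim CollectE conjE)
    have "x \<subseteq> code_disk a" if "a \<in> \<Union>(g x)" for a
      using bspec[OF * that] interior_subset[of "code_disk a"] by (rule order_trans)
    then show ?thesis unfolding deflate_def by (rule INT_greatest)
  qed
  show "\<exists>\<delta>>0. deflate g (cball c (r + \<delta>)) \<subseteq> deflate g (cball c r)" if r: "0 \<le> r" for c r
  proof -
    let ?D = "(\<lambda>\<delta>. cball c (r + \<delta>)) ` {0<..}"
    have D: "directed_in Disc ?D" by (rule directed_thick[OF r])
    have sup: "is_sup Disc (cball c r) ?D" unfolding is_sup_Disc[OF D] Inter_thick ..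
    have dir: "directed_in (Idl code_sets) (g ` ?D)" by (rule directed_in_image[OF sc D])
    have "g (cball c r) = \<Union>(g ` ?D)"
      using scott_continuousD(3)[OF sc D sup] unfolding is_sup_Idl[OF dir] .
    \<comment> \<open>The whole code set in use at \<open>cball c r\<close> is a single element of
      that ideal, so it already occurs at some thicker disk.\<close>
    then have "\<Union>(g (cball c r)) \<in> \<Union>(g ` ?D)" using mem[OF cball_in_Disc[OF r, of c]] by simp
    then obtain \<delta> where \<delta>: "0 < \<delta>" "\<Union>(g (cball c r)) \<in> g (cball c (r + \<delta>))" by auto
    then have "deflate g (cball c (r + \<delta>)) \<subseteq> deflate g (cball c r)"
      by (intro deflate_antimono Union_upper)
    then show ?thesis using \<delta>(1) by blast
  qed
qed

text \<open>Continuity yields approximation pointwise only. A finite net of disks makes it uniform: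
  each net disk needs one code and one map way below the limit, and directedness gives a single map
  above these finitely many.\<close>

lemma not_continuous_Maps: "\<not> continuous_poset Maps"
proof
  assume cont: "continuous_poset Maps"
  define W where "W = {g. way_below Maps g (Cover {})}"
  have W: "directed_in Maps W" "is_sup Maps (Cover {}) W"
    using cont Cover_in_Maps[OF countable_empty] unfolding W_def continuous_poset_def by blast+
  \<comment> \<open>The tolerance 1/40 is halved, one half for passing to the net and one for the
    code. Radius 6 is enough: the centres have norm at most 4 and the disks radius at most
    1.\<close>
  obtain M where M: "finite M" "M \<subseteq> {cball c r |c r. 0 \<le> r}"
    "\<And>c r. 0 \<le> r \<Longrightarrow> cball c r \<subseteq> ball (0 :: real^2) 6 \<Longrightarrow> \<exists>m\<in>M. cball c r \<subseteq> m \<and> m \<subseteq> cball c (r + 1/80)"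
    by (rule disk_net[of "1/80" 6]) simp_all
  have "\<exists>v. \<exists>g\<in>W. {v} \<in> g m \<and> (\<forall>c r. 0 \<le> r \<longrightarrow> m \<subseteq> cball c r \<longrightarrow> code_disk v \<subseteq> cball c (r + 1/80))"
    if m: "m \<in> M" for m
  proof -
    obtain c r where cr: "m = cball c r" "0 \<le> r" using subsetD[OF M(2) m] by blast
    obtain v where v: "cball c r \<subseteq> interior (code_disk v)" "code_disk v \<subseteq> cball c (r + 1/80)"
      using fresh_code[OF countable_empty cr(2), of "1/80" c] by auto
    have "{v} \<in> cover {} m" using v(1) by (simp add: cover_def code_sets_def cr)
    moreover have car: "m \<in> carrier Disc" using cr by simp
    ultimately have "{v} \<in> Cover {} m" by simp
    then have "{v} \<in> (\<Union>g\<in>W. g m)"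
      using is_sup_fun_space_pointwise[OF partial_order_Disc W car] by blast
    then obtain g where g: "g \<in> W" "{v} \<in> g m" by blast
    have "code_disk v \<subseteq> cball c' (r' + 1/80)" if "m \<subseteq> cball c' r'" for c' r'
    proof -
      have "dist c c' + r \<le> r'" using that cr by (simp add: cball_subset_cball_iff)
      then have "cball c (r + 1/80) \<subseteq> cball c' (r' + 1/80)" by (simp add: cball_subset_cball_iff)
      then show ?thesis using v(2) by blast
    qed
    then show ?thesis using g by blast
  qed
  then have "\<exists>v G. \<forall>m\<in>M. G m \<in> W \<and> {v m} \<in> G m m \<and>
      (\<forall>c r. 0 \<le> r \<longrightarrow> m \<subseteq> cball c r \<longrightarrow> code_disk (v m) \<subseteq> cball c (r + 1/80))"
    by metis
  then obtain v G where G: "\<forall>m\<in>M. G m \<in> W \<and> {v m} \<in> G m m \<and>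
      (\<forall>c r. 0 \<le> r \<longrightarrow> m \<subseteq> cball c r \<longrightarrow> code_disk (v m) \<subseteq> cball c (r + 1/80))"
    by (elim exE)
  have "finite (G ` M)" "G ` M \<subseteq> W" using M(1) G by auto
  then have "\<exists>g\<in>W. \<forall>h\<in>G ` M. h \<sqsubseteq>\<^bsub>Maps\<^esub> g"
    by (rule directed_in_finite[OF partial_order_fun_space[OF partial_order_Idl] W(1)])
  then obtain g where g: "g \<in> W" "\<forall>h\<in>G ` M. h \<sqsubseteq>\<^bsub>Maps\<^esub> g" by (elim bexE)
  have wb: "way_below Maps g (Cover {})" using g(1) by (simp add: W_def)
  have sc: "scott_continuous Disc (Idl code_sets) g"
    using wb by (simp add: way_below_def carrier_fun_space)
  show False
  proof (rule no_fine_deflation[OF deflation_from_way_below[OF wb]])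
    fix c :: "real^2" and r :: real
    assume c: "c \<in> cbox 0 (vec 2)" and r: "0 \<le> r" "r \<le> 1"
    have "norm c \<le> \<bar>c $ 1\<bar> + \<bar>c $ 2\<bar>" using norm_le_l1_cart[of c] by (simp add: sum_2)
    moreover have "\<bar>c $ 1\<bar> \<le> 2" "\<bar>c $ 2\<bar> \<le> 2" using c by (simp_all add: mem_box_cart forall_2)
    ultimately have "cball c r \<subseteq> ball 0 6" using r by (simp add: cball_subset_ball_iff)
    then obtain m where m: "m \<in> M" "cball c r \<subseteq> m" "m \<subseteq> cball c (r + 1/80)" using M(3)[OF r(1)] by blast
    have car: "m \<in> carrier Disc" using subsetD[OF M(2) m(1)] by (auto simp: carrier_Disc)
    have "G m \<sqsubseteq>\<^bsub>Maps\<^esub> g" using g(2) m(1) by blast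
    then have "G m m \<subseteq> g m" using car by (simp add: le_fun_space)
    moreover have "g m \<subseteq> g (cball c r)"
      using scott_continuousD(2)[OF sc car cball_in_Disc[OF r(1), of c]] m(2) by simp
    moreover have "{v m} \<in> G m m" using G m(1) by blast
    ultimately have "v m \<in> \<Union>(g (cball c r))" by blast
    then have "deflate g (cball c r) \<subseteq> code_disk (v m)" unfolding deflate_def by (rule INT_lower)
    moreover have "0 \<le> r + 1/80" using r(1) by simp
    then have "code_disk (v m) \<subseteq> cball c (r + 1/80 + 1/80)" using bspec[OF G m(1)] m(3) by blast
    moreover have "r + 1/80 + 1/80 = r + 1/40" by simp
    ultimately show "deflate g (cball c r) \<subseteq> cball c (r + 1/40)" by (simp only: order_trans)
  qed
qed

theorem corollary4p5:
  shows "\<exists>E :: disc_ambient gorder.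
           pointed E \<and> algebraic_domain E \<and>
           FS_domain Disc \<and> \<not> continuous_poset (fun_space Disc E)"
  using pointed_algebraic_Idl[OF empty_in_code_sets] FS_domain_Disc not_continuous_Maps by blast

end
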